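(* Let $G$ be an $H$-type group with structure matrices $U^{(1)},\dots,U^{(m)}$, let $\lambda\in\mathbb R^m\setminus\{0\}$, $r\ge0$ and $p,q\in\mathbb Z_+$. Let $P\in H^\lambda_{p,q}$ and $$h(z)=\frac{e^{\frac{|\lambda|}4|z|^2}P(z)}{|z|^{2(n+p+q-i)}},\qquad\text{where }1\le i\le p.$$ Then $h\in Z_{r,\infty}$.
   Context: **$H$-type group and twisted spherical mean.** $U^{(1)},\dots,U^{(m)}$ are real skew-symmetric orthogonal $2n\times2n$ matrices with $U^{(j)}U^{(l)}+U^{(l)}U^{(j)}=0$ for $j\ne l$; the $H$-type group is $\mathbb R^{2n}\times\mathbb R^m$ with law $(x,t)(\xi,\tau)=(x+\xi,(t_j+\tau_j+\frac12\langle x,U^{(j)}\xi\rangle)_j)$. Identify $x=(x_1,\dots,x_n,y_1,\dots,y_n)\in\mathbb R^{2n}$ with its complexification $z=(x_1+iy_1,\dots,x_n+iy_n)\in\mathbb C^n$; $U^{(j)}w$ denotes the complexification of $U^{(j)}\xi$ if $w$ is that of $\xi$, and $z\cdot w=\sum_jz_jw_j$. With $\mu_s$ the normalized surface measure on $\{|w|=s\}\subset\mathbb C^n$, $$f\times_\lambda\mu_s(z)=\int_{|w|=s}f(z-w)\,e^{\frac i2\sum_{j=1}^m\lambda_j\mathrm{Re}(z\cdot\overline{U^{(j)}w})}\,d\mu_s(w).$$ For $0\le r<R\le\infty$ and $B_{r,R}=\{z\in\mathbb C^n:r<|z|<R\}$, $Z_{r,R}$ is the space of continuous functions $f$ on $B_{r,R}$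 with $f\times_\lambda\mu_s(z)=0$ for all $z,s$ such that the sphere $S_s(z)\subset B_{r,R}$ and the ball $B_r(0)\subseteq B_s(z)$. **The space $H^\lambda_{p,q}$.** $V_\lambda=\sum_j\lambda_jU^{(j)}$ is skew-symmetric with eigenvalues $\pm i|\lambda|$ (each of multiplicity $n$). Let $u_j\pm iv_j$ ($1\le j\le n$) be eigenvectors for $\pm i|\lambda|$ chosen so that $A_\lambda=(\sqrt2v_1,\dots,\sqrt2v_n,\sqrt2u_1,\dots,\sqrt2u_n)$ is orthogonal; then $V_\lambda A_\lambda=A_\lambda\begin{pmatrix}0&-|\lambda|I\\|\lambda|I&0\end{pmatrix}$. If $z$ is the complexification of $x$, $\tilde z_\lambda$ is the complexification of $A_\lambda x$, and $f_\lambda(z)=f(\tilde z_\lambda)$. $H_{p,q}$ is the space of harmonic polynomials on $\mathbb C^n$ of the form $\sum_{|\alpha|=p,|\beta|=q}c_{\alpha\beta}z^\alpha\bar z^\beta$, and $H^\lambda_{p,q}=\{P\in\bigoplus_{p'+q'=p+q}H_{p',q'}:P_\lambda\in H_{p,q}\}$. *)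

theory Defs
  imports "HOL-Analysis.Analysis"
begin

text \<open>Throughout, \<open>\<real>\<^sup>2\<^sup>n\<close> is \<^typ>\<open>real^('n + 'n)\<close>: the coordinate \<^term>\<open>Inl j\<close> is \<open>x\<^sub>j\<close> and the
  coordinate \<^term>\<open>Inr j\<close> is \<open>y\<^sub>j\<close>.\<close>

definition complexify :: "real^('n + 'n) \<Rightarrow> complex^'n" where
  "complexify x = (\<chi> j. Complex (x $ Inl j) (x $ Inr j))"

definition realify :: "complex^'n \<Rightarrow> real^('n + 'n)" where
  "realify z = (\<chi> k. case k of Inl j \<Rightarrow> Re (z $ j) | Inr j \<Rightarrow> Im (z $ j))"

lemma complexify_realify [simp]: "complexify (realify z) = z"
  by (simp add: complexify_def realify_def vec_eq_iff)

lemma realify_complexify [simp]: "realify (complexify x) = x"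
  by (simp add: complexify_def realify_def vec_eq_iff split: sum.split)

definition cact :: "real^('n::finite + 'n)^('n + 'n) \<Rightarrow> complex^'n \<Rightarrow> complex^'n" where
  "cact M z = complexify (M *v realify z)"

definition cdot :: "complex^'n::finite \<Rightarrow> complex^'n \<Rightarrow> complex" where
  "cdot z w = (\<Sum>j\<in>UNIV. z $ j * w $ j)"

definition vcnj :: "complex^'n \<Rightarrow> complex^'n" where
  "vcnj z = (\<chi> j. cnj (z $ j))"

definition htype_matrices :: "('m::finite \<Rightarrow> real^('n::finite + 'n)^('n + 'n)) \<Rightarrow> bool" where
  "htype_matrices U \<longleftrightarrow>
     (\<forall>j. transpose (U j) = - U j \<and> orthogonal_matrix (U j)) \<and>
     (\<forall>j l. j \<noteq> l \<longrightarrow> U j ** U l + U l ** U j = 0)"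

text \<open>The group law is not used below, where the group enters only through its structure
  matrices and the twisted spherical means they define.\<close>

definition htype_mult ::
  "('m::finite \<Rightarrow> real^('n::finite + 'n)^('n + 'n)) \<Rightarrow>
   (real^('n + 'n)) \<times> (real^'m) \<Rightarrow> (real^('n + 'n)) \<times> (real^'m) \<Rightarrow> (real^('n + 'n)) \<times> (real^'m)" where
  "htype_mult U = (\<lambda>(x, t) (\<xi>, \<tau>). (x + \<xi>, \<chi> j. t $ j + \<tau> $ j + (x \<bullet> (U j *v \<xi>)) / 2))"

text \<open>The normalized surface measure on the sphere \<open>|w| = s\<close>, for \<^prop>\<open>s > 0\<close>, obtained from polar
  coordinates: a Borel set of the sphere is measured by the proportion of the volume of the
  ball that is contained in the cone over it.\<close>

definition normalized_sphere_measure :: "real \<Rightarrow> 'a::euclidean_space measure" where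
  "normalized_sphere_measure s =
     distr (uniform_measure lborel (ball 0 1)) borel (\<lambda>x. s *\<^sub>R sgn x)"

text \<open>The integral is restricted to the sphere because \<open>f\<close> may be arbitrary, even non-measurable,
  off its domain; without the restriction the Bochner integral of such an \<open>f\<close> would be 0.\<close>

definition twisted_mean ::
  "('m::finite \<Rightarrow> real^('n::finite + 'n)^('n + 'n)) \<Rightarrow> real^'m \<Rightarrow>
   (complex^'n \<Rightarrow> complex) \<Rightarrow> real \<Rightarrow> complex^'n \<Rightarrow> complex" where
  "twisted_mean U lam f s z =
     (LINT w : sphere 0 s | normalized_sphere_measure s.
        f (z - w) *
        exp (\<i> / 2 * of_real (\<Sum>j\<in>UNIV. lam $ j * Re (cdot z (vcnj (cact (U j) w))))))"

definition annulus :: "real \<Rightarrow> ereal \<Rightarrow> (complex^'n::finite) set" where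
  "annulus r R = {z. r < norm z \<and> ereal (norm z) < R}"

text \<open>The balls in the condition \<open>B\<^sub>r(0) \<subseteq> B\<^sub>s(z)\<close> are closed. For \<^prop>\<open>r > 0\<close> open balls give the same
  condition, since the sphere lies in the annulus; for \<^prop>\<open>r = 0\<close> the open ball would be empty,
  whereas the condition has to say that the sphere encloses the origin.\<close>

definition Z_space ::
  "('m::finite \<Rightarrow> real^('n::finite + 'n)^('n + 'n)) \<Rightarrow> real^'m \<Rightarrow> real \<Rightarrow> ereal \<Rightarrow>
   (complex^'n \<Rightarrow> complex) set" where
  "Z_space U lam r R =
     {f. continuous_on (annulus r R) f \<and>
         (\<forall>z s. s > 0 \<longrightarrow> sphere z s \<subseteq> annulus r R \<longrightarrow> cball 0 r \<subseteq> cball z s \<longrightarrow>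
                twisted_mean U lam f s z = 0)}"

definition partial_deriv :: "'a::real_normed_vector \<Rightarrow> ('a \<Rightarrow> complex) \<Rightarrow> 'a \<Rightarrow> complex" where
  "partial_deriv b f x = vector_derivative (\<lambda>t. f (x + t *\<^sub>R b)) (at 0)"

definition laplacian :: "('a::euclidean_space \<Rightarrow> complex) \<Rightarrow> 'a \<Rightarrow> complex" where
  "laplacian f x = (\<Sum>b\<in>Basis. partial_deriv b (partial_deriv b f) x)"

definition multi_power :: "complex^'n::finite \<Rightarrow> ('n \<Rightarrow> nat) \<Rightarrow> complex" where
  "multi_power z \<alpha> = (\<Prod>j\<in>UNIV. z $ j ^ \<alpha> j)"

definition multi_indices :: "nat \<Rightarrow> ('n::finite \<Rightarrow> nat) set" where
  "multi_indices p = {\<alpha>. (\<Sum>j\<in>UNIV. \<alpha> j) = p}"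

lemma finite_multi_indices: "finite (multi_indices p :: ('n::finite \<Rightarrow> nat) set)"
proof (rule finite_subset)
  have "\<alpha> j \<le> p" if "(\<Sum>j\<in>UNIV. \<alpha> j) = p" for \<alpha> :: "'n \<Rightarrow> nat" and j
    using member_le_sum[of j UNIV \<alpha>] that by simp
  then show "multi_indices p \<subseteq> (PiE UNIV (\<lambda>_. {..p}) :: ('n \<Rightarrow> nat) set)"
    by (auto simp: multi_indices_def)
  show "finite (PiE UNIV (\<lambda>_. {..p}) :: ('n \<Rightarrow> nat) set)"
    by (intro finite_PiE) auto
qed

definition H_space :: "nat \<Rightarrow> nat \<Rightarrow> (complex^'n::finite \<Rightarrow> complex) set" where
  "H_space p q =
     {P. (\<exists>c. P = (\<lambda>z. \<Sum>\<alpha>\<in>multi_indices p. \<Sum>\<beta>\<in>multi_indices q.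
                          c \<alpha> \<beta> * multi_power z \<alpha> * multi_power (vcnj z) \<beta>)) \<and>
         (\<forall>z. laplacian P z = 0)}"

definition H_sum :: "nat \<Rightarrow> (complex^'n::finite \<Rightarrow> complex) set" where
  "H_sum d =
     {P. \<exists>F. (\<forall>p' q'. p' + q' = d \<longrightarrow> F (p', q') \<in> H_space p' q') \<and>
             P = (\<lambda>z. \<Sum>k\<in>{(p', q'). p' + q' = d}. F k z)}"

lemma finite_bidegrees: "finite {(p', q'). p' + q' = (d::nat)}"
  by (rule finite_subset[of _ "{..d} \<times> {..d}"]) auto

definition V_mat ::
  "('m::finite \<Rightarrow> real^('n::finite + 'n)^('n + 'n)) \<Rightarrow> real^'m \<Rightarrow> real^('n + 'n)^('n + 'n)" where
  "V_mat U lam = (\<Sum>j\<in>UNIV. lam $ j *\<^sub>R U j)"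

definition A_mat ::
  "('n::finite \<Rightarrow> real^('n + 'n)) \<Rightarrow> ('n \<Rightarrow> real^('n + 'n)) \<Rightarrow> real^('n + 'n)^('n + 'n)" where
  "A_mat u v =
     (\<chi> k l. case l of Inl j \<Rightarrow> sqrt 2 * v j $ k | Inr j \<Rightarrow> sqrt 2 * u j $ k)"

definition eigenvector :: "complex^'k::finite^'k \<Rightarrow> complex \<Rightarrow> complex^'k \<Rightarrow> bool" where
  "eigenvector M \<mu> w \<longleftrightarrow> w \<noteq> 0 \<and> M *v w = \<mu> *s w"

text \<open>Any two choices of \<open>u\<close> and \<open>v\<close> satisfying the following condition give matrices \<open>A\<^sub>\<lambda>\<close> that
  differ by a unitary change of the variable \<open>z\<close>, so the space \<open>H\<^sup>\<lambda>\<^sub>p\<^sub>,\<^sub>q\<close> does not depend on the choice.\<close>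

definition eigenframe ::
  "('m::finite \<Rightarrow> real^('n::finite + 'n)^('n + 'n)) \<Rightarrow> real^'m \<Rightarrow>
   ('n \<Rightarrow> real^('n + 'n)) \<Rightarrow> ('n \<Rightarrow> real^('n + 'n)) \<Rightarrow> bool" where
  "eigenframe U lam u v \<longleftrightarrow>
     (\<forall>j. eigenvector (map_matrix of_real (V_mat U lam)) (\<i> * of_real (norm lam))
             (\<chi> k. of_real (u j $ k) + \<i> * of_real (v j $ k)) \<and>
          eigenvector (map_matrix of_real (V_mat U lam)) (- \<i> * of_real (norm lam))
             (\<chi> k. of_real (u j $ k) - \<i> * of_real (v j $ k))) \<and>
     orthogonal_matrix (A_mat u v)"

definition H_lambda_space ::
  "('n::finite \<Rightarrow> real^('n + 'n)) \<Rightarrow> ('n \<Rightarrow> real^('n + 'n)) \<Rightarrow> nat \<Rightarrow> nat \<Rightarrow>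
   (complex^'n \<Rightarrow> complex) set" where
  "H_lambda_space u v p q =
     {P \<in> H_sum (p + q). (\<lambda>z. P (cact (A_mat u v) z)) \<in> H_space p q}"

end

theory Submission
  imports Defs
begin

text \<open>
Let \<open>|z| < s\<close>; the spheres in the definition of the space \<open>Z\<close> are of this kind, because they avoid
0 and enclose it. The orthogonal map \<open>A\<^sub>\<lambda>\<close> turns the twist into \<open>exp (i |\<lambda>| Im (z \<cdot> w\<^sup>*) / 2)\<close>, where
the star denotes conjugation, and turns \<open>P\<close> into an element of \<open>H\<^sub>p\<^sub>,\<^sub>q\<close>. With \<open>x = z - w\<close>, the
identity \<open>|x|\<^sup>2 = s\<^sup>2 - |z|\<^sup>2 + 2 Re (z\<^sup>* \<cdot> x)\<close> on the sphere shows that the Gaussian factor and the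
twist together are a constant multiple of the holomorphic function \<open>exp (b \<cdot> x)\<close>, where
\<open>b = |\<lambda>| z\<^sup>* / 2\<close> (\<open>gaussian_twist_on_sphere\<close>). So it has to be shown that the ordinary mean of
\<open>exp (b \<cdot> x) P(x) / |x|\<^sup>2\<^sup>(\<^sup>n\<^sup>+\<^sup>p\<^sup>+\<^sup>q\<^sup>-\<^sup>i\<^sup>)\<close> over the sphere of radius \<open>s\<close> about \<open>z\<close> is 0; this is
\<open>weighted_harmonic_mean_vanishes\<close>.

The mean is computed in polar coordinates about 0 instead of \<open>z\<close> (\<open>eccentric_mean\<close>). The ray in the
direction of the unit vector \<open>w\<close> meets the sphere at distance \<open>\<rho> = \<xi> + D\<close>, where
\<open>\<xi> = z \<bullet> w\<close> and \<open>D\<^sup>2 = \<xi>\<^sup>2 + s\<^sup>2 - |z|\<^sup>2\<close>, and the mean is up to a positive factor the integral of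
\<open>P(w) \<rho>\<^sup>2\<^sup>i\<^sup>-\<^sup>p\<^sup>-\<^sup>q\<^sup>-\<^sup>1 exp (\<rho> b \<cdot> w) / D\<close> over the unit sphere. In the exponential series the term of
order \<open>k\<close> gives \<open>P(w) (b \<cdot> w)\<^sup>k \<rho>\<^sup>m / D\<close> with \<open>m = 2i - p - q - 1 + k\<close>. Averaging over \<open>w\<close> and \<open>- w\<close>
replaces \<open>\<rho>\<^sup>m / D\<close> by half of \<open>((\<xi> + D)\<^sup>m - (\<xi> - D)\<^sup>m) / D\<close>, which is a polynomial in \<open>\<xi>\<close> of
degree less than \<open>|m|\<close> (\<open>integral_sphere_ray_power\<close>).

It remains to see that \<open>P(w) (b \<cdot> w)\<^sup>k (z \<bullet> w)\<^sup>l\<close> has mean 0 on the unit sphere whenever \<open>l < |m|\<close>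
(\<open>H_space_integral_vanishes\<close>). For \<open>m < 0\<close> this holds since \<open>k + l < p + q\<close> and harmonic polynomials are
orthogonal to polynomials of lower degree (\<open>harmonic_orthogonal_lower_degree\<close>); for \<open>m > 0\<close> the
condition \<open>i \<le> p\<close> makes all frequencies under \<open>w \<mapsto> u w\<close>, \<open>|u| = 1\<close>, positive.

All facts about the sphere are derived from its definition through the volume of cones and from
the invariance of Lebesgue measure under isometries; in particular integration by parts on the
sphere is the infinitesimal form of the rotation invariance of the mean.
\<close>

section \<open>Lebesgue measure and linear isometries\<close>

lemma linear_isometry_surj:
  fixes T :: "'a::euclidean_space \<Rightarrow> 'a"
  assumes "linear T" "\<And>x. norm (T x) = norm x"
  shows "surj T"
proof -
  have "inj T"
    using assms(1) by (rule linear_injective_0[THEN iffD2]) (metis assms(2) norm_eq_zero)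
  then show ?thesis by (rule linear_inj_imp_surj[OF assms(1)])
qed

lemma measurable_linear:
  fixes T :: "'a::euclidean_space \<Rightarrow> 'a"
  assumes "linear T"
  shows "T \<in> borel_measurable borel"
  using assms by (intro borel_measurable_continuous_onI linear_continuous_on) (simp add: linear_linear)

lemma nn_integral_lborel_translate:
  fixes f :: "'a::euclidean_space \<Rightarrow> ennreal"
  assumes [measurable]: "f \<in> borel_measurable borel"
  shows "(\<integral>\<^sup>+x. f (c + x) \<partial>lborel) = (\<integral>\<^sup>+x. f x \<partial>lborel)"
  by (subst (2) lborel_distr_plus[of c, symmetric]) (simp add: nn_integral_distr)

lemma nn_integral_lborel_scaleR:
  fixes f :: "'a::euclidean_space \<Rightarrow> ennreal"
  assumes [measurable]: "f \<in> borel_measurable borel" and "c > 0"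
  shows "(\<integral>\<^sup>+x. f x \<partial>lborel) = ennreal (c ^ DIM('a)) * (\<integral>\<^sup>+x. f (c *\<^sub>R x) \<partial>lborel)"
  using assms(2)
  by (subst (1) lborel_affine[of c 0]) (simp_all add: nn_integral_density nn_integral_distr nn_integral_cmult)

lemma ball_in_borel [measurable]: "ball x e \<in> sets borel"
  by (simp add: borel_open)

text \<open>Write \<open>I(f)\<close> for the integral of \<open>f \<circ> T\<close>. It does not change if \<open>f\<close> is translated, because \<open>T\<close> is
onto and Lebesgue measure is translation invariant. Integrating \<open>g(y) f(T x + y)\<close> in both orders
therefore compares \<open>I(f)\<close> with the integral of \<open>f\<close>; taking for \<open>g\<close> the indicator of the unit
ball, which \<open>T\<close> preserves, shows that the constant of proportionality is 1. No matrix and no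
determinant enters, so the result holds in every Euclidean space.\<close>

lemma nn_integral_lborel_isometry:
  fixes T :: "'a::euclidean_space \<Rightarrow> 'a" and f :: "'a \<Rightarrow> ennreal"
  assumes T: "linear T" "\<And>x. norm (T x) = norm x"
    and [measurable]: "f \<in> borel_measurable borel"
  shows "(\<integral>\<^sup>+x. f (T x) \<partial>lborel) = (\<integral>\<^sup>+x. f x \<partial>lborel)"
proof -
  note [measurable] = measurable_linear[OF T(1)]
  define g :: "'a \<Rightarrow> ennreal" where "g = indicator (ball 0 1)"
  have [measurable]: "g \<in> borel_measurable borel" unfolding g_def by (intro borel_measurable_indicator) (simp add: borel_open)
  define \<beta> where "\<beta> = emeasure lborel (ball (0::'a) 1)"
  have \<beta>: "\<beta> \<noteq> 0" "\<beta> \<noteq> \<infinity>"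
    using emeasure_lborel_ball_finite[of "0::'a" 1] content_ball_pos[of 1 "0::'a"] 
    by (auto simp: \<beta>_def measure_def)
  have gint: "(\<integral>\<^sup>+y. g y \<partial>lborel) = \<beta>" by (simp add: g_def \<beta>_def)
  have "\<beta> * (\<integral>\<^sup>+x. f (T x) \<partial>lborel) = (\<integral>\<^sup>+y. g y * (\<integral>\<^sup>+x. f (T x) \<partial>lborel) \<partial>lborel)"
    by (simp add: nn_integral_multc gint)
  also have "\<dots> = (\<integral>\<^sup>+y. (\<integral>\<^sup>+x. g y * f (T x + y) \<partial>lborel) \<partial>lborel)"
  proof (rule nn_integral_cong)
    fix y
    obtain c where c: "y = T c" using linear_isometry_surj[OF T] by (metis surjD)
    have "(\<integral>\<^sup>+x. f (T x) \<partial>lborel) = (\<integral>\<^sup>+x. f (T (c + x)) \<partial>lborel)"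
      by (rule nn_integral_lborel_translate[symmetric]) simp
    also have "\<dots> = (\<integral>\<^sup>+x. f (T x + y) \<partial>lborel)"
      by (simp add: c linear_add[OF T(1)] add.commute)
    finally show "g y * (\<integral>\<^sup>+x. f (T x) \<partial>lborel) = (\<integral>\<^sup>+x. g y * f (T x + y) \<partial>lborel)"
      by (simp add: nn_integral_cmult)
  qed
  also have "\<dots> = (\<integral>\<^sup>+x. (\<integral>\<^sup>+y. g y * f (T x + y) \<partial>lborel) \<partial>lborel)"
    by (rule lborel_pair.Fubini') simp
  also have "\<dots> = (\<integral>\<^sup>+x. (\<integral>\<^sup>+y. g (y - T x) * f y \<partial>lborel) \<partial>lborel)"
  proof (rule nn_integral_cong)
    fix x
    show "(\<integral>\<^sup>+y. g y * f (T x + y) \<partial>lborel) = (\<integral>\<^sup>+y. g (y - T x) * f y \<partial>lborel)"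
      using nn_integral_lborel_translate[of "\<lambda>y. g (y - T x) * f y" "T x"] by simp
  qed
  also have "\<dots> = (\<integral>\<^sup>+y. (\<integral>\<^sup>+x. g (y - T x) * f y \<partial>lborel) \<partial>lborel)"
    by (rule lborel_pair.Fubini') simp
  also have "\<dots> = (\<integral>\<^sup>+y. \<beta> * f y \<partial>lborel)"
  proof (rule nn_integral_cong)
    fix y
    obtain c where c: "y = T c" using linear_isometry_surj[OF T] by (metis surjD)
    have "(\<integral>\<^sup>+x. g (y - T x) \<partial>lborel) = (\<integral>\<^sup>+x. indicator (ball c 1) x \<partial>lborel)"
      by (intro nn_integral_cong)
         (simp add: g_def c indicator_def dist_norm T(2) flip: linear_diff[OF T(1)])
    also have "\<dots> = \<beta>"
      using nn_integral_lborel_translate[of "indicator (ball c 1)" c,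
          OF borel_measurable_indicator[OF ball_in_borel]]
      by (simp add: \<beta>_def indicator_def dist_norm if_distrib[of ennreal] flip: nn_integral_indicator)
    finally show "(\<integral>\<^sup>+x. g (y - T x) * f y \<partial>lborel) = \<beta> * f y"
      by (simp add: nn_integral_multc)
  qed
  finally have "\<beta> * (\<integral>\<^sup>+x. f (T x) \<partial>lborel) = \<beta> * (\<integral>\<^sup>+x. f x \<partial>lborel)"
    by (simp add: nn_integral_cmult)
  with \<beta> show ?thesis by (simp add: ennreal_mult_cancel_left)
qed

section \<open>The uniform probability measure on the unit sphere\<close>

abbreviation unit_sphere_measure :: "'a::euclidean_space measure"
  where "unit_sphere_measure \<equiv> normalized_sphere_measure 1"

lemma sets_normalized_sphere_measure [simp, measurable_cong]:
  "sets (normalized_sphere_measure s) = sets borel"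
  by (simp add: normalized_sphere_measure_def)

lemma space_normalized_sphere_measure [simp]: "space (normalized_sphere_measure s) = UNIV"
  by (simp add: normalized_sphere_measure_def)

lemma measurable_normalized_sphere_measure [simp]:
  "measurable (normalized_sphere_measure s) N = measurable borel N"
  by (intro measurable_cong_sets) auto

lemma measurable_sgn [measurable]: "(sgn :: 'a::euclidean_space \<Rightarrow> 'a) \<in> borel_measurable borel"
  unfolding sgn_div_norm[abs_def] by measurable

lemma measurable_uniform_measure_lborel [measurable (raw)]:
  "f \<in> measurable borel N \<Longrightarrow> f \<in> measurable (uniform_measure lborel A) N"
  using measurable_cong_sets[of "uniform_measure lborel A" borel N N] by simp

lemma emeasure_unit_ball_bounds:
  "emeasure lborel (ball (0::'a::euclidean_space) 1) \<noteq> 0"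
  "emeasure lborel (ball (0::'a::euclidean_space) 1) \<noteq> \<infinity>"
    using emeasure_lborel_ball_finite[of "0::'a" 1] content_ball_pos[of 1 "0::'a"] 
    by (auto simp: measure_def)


lemma finite_measure_normalized_sphere_measure:
  "finite_measure (normalized_sphere_measure s :: 'a::euclidean_space measure)"
  unfolding normalized_sphere_measure_def
  using emeasure_unit_ball_bounds[where 'a='a]
  by (intro finite_measure.finite_measure_distr finite_measureI)
     (auto simp: ennreal_divide_self top.not_eq_extremum)

lemma nn_integral_normalized_sphere_measure:
  fixes f :: "'a::euclidean_space \<Rightarrow> ennreal"
  assumes [measurable]: "f \<in> borel_measurable borel"
  shows "(\<integral>\<^sup>+x. f x \<partial>normalized_sphere_measure s) =
    (\<integral>\<^sup>+x. f (s *\<^sub>R sgn x) * indicator (ball 0 1) x \<partial>lborel) / emeasure lborel (ball (0::'a) 1)"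
  unfolding normalized_sphere_measure_def
  by (simp add: nn_integral_distr nn_integral_uniform_measure)

lemma AE_unit_sphere_measure: "AE w in unit_sphere_measure. norm (w::'a::euclidean_space) = 1"
proof -
  have "AE x in lborel. (x::'a) \<noteq> 0"
    using AE_lborel_singleton[of 0] by simp
  then have "AE x in uniform_measure lborel (ball 0 1). (x::'a) \<noteq> 0"
    by (intro AE_uniform_measureI) auto
  then show ?thesis
    unfolding normalized_sphere_measure_def
    by (subst AE_distr_iff) (auto simp: norm_sgn)
qed

lemma normalized_sphere_measure_eq_distr:
  "normalized_sphere_measure s = distr unit_sphere_measure borel (\<lambda>w::'a::euclidean_space. s *\<^sub>R w)"
  unfolding normalized_sphere_measure_def
  by (subst distr_distr) (auto simp: comp_def)

lemma distr_unit_sphere_measure_isometry: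
  fixes T :: "'a::euclidean_space \<Rightarrow> 'a"
  assumes T: "linear T" "\<And>x. norm (T x) = norm x"
  shows "distr unit_sphere_measure borel T = unit_sphere_measure"
proof (rule measure_eqI)
  note [measurable] = measurable_linear[OF T(1)]
  fix A :: "'a set" assume "A \<in> sets (distr unit_sphere_measure borel T)"
  then have [measurable]: "A \<in> sets borel" by simp
  have sg: "T (sgn x) = sgn (T x)" for x
    by (simp add: sgn_div_norm T(2) linear_cmul[OF T(1)])
  have "emeasure (distr unit_sphere_measure borel T) A = (\<integral>\<^sup>+x. indicator A x \<partial>distr unit_sphere_measure borel T)"
    by simp
  also have "\<dots> = (\<integral>\<^sup>+x. indicator A (T x) \<partial>unit_sphere_measure)"
    by (rule nn_integral_distr) simp_all
  also have "\<dots> = (\<integral>\<^sup>+x. indicator A (sgn (T x)) * indicator (ball 0 1) (T x) \<partial>lborel) / emeasure lborel (ball (0::'a) 1)"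
    by (subst nn_integral_normalized_sphere_measure) (simp_all add: sg T(2) indicator_def)
  also have "\<dots> = (\<integral>\<^sup>+x. indicator A (sgn x) * indicator (ball 0 1) x \<partial>lborel) / emeasure lborel (ball (0::'a) 1)"
    by (subst nn_integral_lborel_isometry[OF T, of "\<lambda>x. indicator A (sgn x) * indicator (ball 0 1) x"]) simp_all
  also have "\<dots> = (\<integral>\<^sup>+x. indicator A x \<partial>unit_sphere_measure)"
    by (subst nn_integral_normalized_sphere_measure) simp_all
  finally show "emeasure (distr unit_sphere_measure borel T) A = emeasure unit_sphere_measure A" by simp
qed simp

lemma integral_unit_sphere_measure_isometry:
  fixes T :: "'a::euclidean_space \<Rightarrow> 'a" and f :: "'a \<Rightarrow> 'b::{banach, second_countable_topology}"
  assumes T: "linear T" "\<And>x. norm (T x) = norm x"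
    and [measurable]: "f \<in> borel_measurable borel"
  shows "(LINT w|unit_sphere_measure. f (T w)) = (LINT w|unit_sphere_measure. f w)"
  using measurable_linear[OF T(1)]
  by (subst (2) distr_unit_sphere_measure_isometry[OF T, symmetric]) (simp add: integral_distr)

lemma integrable_unit_sphere_measure:
  fixes f :: "'a::euclidean_space \<Rightarrow> 'b::{banach, second_countable_topology}"
  assumes "continuous_on UNIV f"
  shows "integrable unit_sphere_measure f"
proof -
  interpret finite_measure "unit_sphere_measure :: 'a measure"
    by (rule finite_measure_normalized_sphere_measure)
  have "compact (f ` sphere 0 1)"
    using assms by (intro compact_continuous_image) (auto intro: continuous_on_subset)
  then obtain B where B: "\<And>x. x \<in> sphere 0 1 \<Longrightarrow> norm (f x) \<le> B"
    by (meson bounded_iff compact_imp_bounded imageI)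
  show ?thesis
  proof (rule integrable_const_bound)
    show "AE x in unit_sphere_measure. norm (f x) \<le> B"
      using AE_unit_sphere_measure by eventually_elim (simp add: B)
    show "f \<in> borel_measurable unit_sphere_measure"
      using borel_measurable_continuous_onI[OF assms] by simp
  qed
qed

section \<open>Polar coordinates\<close>

text \<open>In the double integral of \<open>r\<^sup>N\<^sup>-\<^sup>1 f(r sgn y)\<close> over \<open>y\<close> in the unit ball and \<open>r > 0\<close>, the substitutions
\<open>r = t |y|\<close> and then \<open>x = t y\<close> move the direction of \<open>y\<close> into \<open>x\<close>, and what is left of the radial
variable is the integral of \<open>|x|\<^sup>N t\<^sup>-\<^sup>N\<^sup>-\<^sup>1\<close> over \<open>t > |x|\<close>, which equals \<open>1/N\<close>.\<close>

theorem nn_integral_polar: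
  fixes f :: "'a::euclidean_space \<Rightarrow> ennreal"
  assumes [measurable]: "f \<in> borel_measurable borel"
  shows "(\<integral>\<^sup>+x. f x \<partial>lborel) = ennreal DIM('a) * emeasure lborel (ball (0::'a) 1) *
    (\<integral>\<^sup>+r. ennreal (r ^ (DIM('a) - 1)) * indicator {0<..} r * (\<integral>\<^sup>+w. f (r *\<^sub>R w) \<partial>unit_sphere_measure) \<partial>lborel)"
proof -
  interpret finite_measure "unit_sphere_measure :: 'a measure"
    by (rule finite_measure_normalized_sphere_measure)
  define N where "N = DIM('a)"
  have N: "N \<ge> 1" by (simp add: N_def Suc_leI)
  define \<beta> where "\<beta> = emeasure lborel (ball (0::'a) 1)"
  have \<beta>: "\<beta> \<noteq> 0" "\<beta> \<noteq> \<infinity>" using emeasure_unit_ball_bounds by (auto simp: \<beta>_def)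
  define B where "B = ball (0::'a) 1"
  have [measurable]: "B \<in> sets borel" by (simp add: B_def)
  have key: "\<beta> * (\<integral>\<^sup>+w. f (r *\<^sub>R w) \<partial>unit_sphere_measure) = (\<integral>\<^sup>+y. f (r *\<^sub>R sgn y) * indicator B y \<partial>lborel)" for r
  proof -
    have "b * (c / b) = c" if "b \<noteq> 0" "b \<noteq> top" for b c :: ennreal
      using that by (simp add: ennreal_times_divide mult.commute[of b] mult_divide_eq_ennreal)
    from this[of \<beta>] \<beta> show ?thesis
      by (subst nn_integral_normalized_sphere_measure, measurable) (simp add: B_def \<beta>_def)
  qed
  have "ennreal N * \<beta> * (\<integral>\<^sup>+r. ennreal (r ^ (N - 1)) * indicator {0<..} r * (\<integral>\<^sup>+w. f (r *\<^sub>R w) \<partial>unit_sphere_measure) \<partial>lborel)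
     = ennreal N * (\<integral>\<^sup>+r. ennreal (r ^ (N - 1)) * indicator {0<..} r * (\<beta> * (\<integral>\<^sup>+w. f (r *\<^sub>R w) \<partial>unit_sphere_measure)) \<partial>lborel)"
    by (subst mult.assoc, subst nn_integral_cmult[symmetric]) (simp_all add: mult_ac)
  also have "\<dots> = ennreal N * (\<integral>\<^sup>+r. (\<integral>\<^sup>+y. ennreal (r ^ (N - 1)) * indicator {0<..} r * f (r *\<^sub>R sgn y) * indicator B y \<partial>lborel) \<partial>lborel)"
    by (simp add: key nn_integral_cmult mult.assoc)
  also have "\<dots> = ennreal N * (\<integral>\<^sup>+y. (\<integral>\<^sup>+r. ennreal (r ^ (N - 1)) * indicator {0<..} r * f (r *\<^sub>R sgn y) * indicator B y \<partial>lborel) \<partial>lborel)"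
    by (subst lborel_pair.Fubini') (simp_all)
  also have "(\<integral>\<^sup>+y. (\<integral>\<^sup>+r. ennreal (r ^ (N - 1)) * indicator {0<..} r * f (r *\<^sub>R sgn y) * indicator B y \<partial>lborel) \<partial>lborel)
     = (\<integral>\<^sup>+y. (\<integral>\<^sup>+t. ennreal (t ^ (N - 1)) * ennreal (norm y ^ N) * indicator {0<..} t * f (t *\<^sub>R y) * indicator B y \<partial>lborel) \<partial>lborel)"
  proof (rule nn_integral_cong_AE)
    have "AE y in lborel. (y::'a) \<noteq> 0" using AE_lborel_singleton[of 0] by simp
    then show "AE y in lborel. (\<integral>\<^sup>+r. ennreal (r ^ (N - 1)) * indicator {0<..} r * f (r *\<^sub>R sgn y) * indicator B y \<partial>lborel)
        = (\<integral>\<^sup>+t. ennreal (t ^ (N - 1)) * ennreal (norm y ^ N) * indicator {0<..} t * f (t *\<^sub>R y) * indicator B y \<partial>lborel)"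
    proof eventually_elim
      fix y :: 'a assume y: "y \<noteq> 0"
      have e: "norm y ^ N = norm y * norm y ^ (N - 1)" using N by (cases N) auto
      have "(\<integral>\<^sup>+r. ennreal (r ^ (N - 1)) * indicator {0<..} r * f (r *\<^sub>R sgn y) * indicator B y \<partial>lborel)
         = ennreal (norm y) * (\<integral>\<^sup>+t. ennreal ((norm y * t) ^ (N - 1)) * indicator {0<..} (norm y * t) * f ((norm y * t) *\<^sub>R sgn y) * indicator B y \<partial>lborel)"
        using y by (subst nn_integral_real_affine[where c = "norm y" and t = 0]) simp_all
      also have "\<dots> = (\<integral>\<^sup>+t. ennreal (norm y) * (ennreal ((norm y * t) ^ (N - 1)) * indicator {0<..} (norm y * t) * f ((norm y * t) *\<^sub>R sgn y) * indicator B y) \<partial>lborel)"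
        by (rule nn_integral_cmult[symmetric]) simp
      also have "\<dots> = (\<integral>\<^sup>+t. ennreal (t ^ (N - 1)) * ennreal (norm y ^ N) * indicator {0<..} t * f (t *\<^sub>R y) * indicator B y \<partial>lborel)"
      proof (rule nn_integral_cong)
        fix t :: real
        have "(norm y * t) *\<^sub>R sgn y = t *\<^sub>R y" using y by (simp add: sgn_div_norm)
        moreover have "t > 0 \<Longrightarrow> ennreal (norm y) * ennreal ((norm y * t) ^ (N - 1)) = ennreal (t ^ (N - 1)) * ennreal (norm y ^ N)"
          by (subst (1 2) ennreal_mult[symmetric]) (simp_all add: e power_mult_distrib mult_ac)
        ultimately show "ennreal (norm y) * (ennreal ((norm y * t) ^ (N - 1)) * indicator {0<..} (norm y * t) * f ((norm y * t) *\<^sub>R sgn y) * indicator B y)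
           = ennreal (t ^ (N - 1)) * ennreal (norm y ^ N) * indicator {0<..} t * f (t *\<^sub>R y) * indicator B y"
          using y by (simp add: indicator_def zero_less_mult_iff mult.assoc[symmetric])
      qed
      finally show "(\<integral>\<^sup>+r. ennreal (r ^ (N - 1)) * indicator {0<..} r * f (r *\<^sub>R sgn y) * indicator B y \<partial>lborel)
        = (\<integral>\<^sup>+t. ennreal (t ^ (N - 1)) * ennreal (norm y ^ N) * indicator {0<..} t * f (t *\<^sub>R y) * indicator B y \<partial>lborel)" .
    qed
  qed
  also have "\<dots> = (\<integral>\<^sup>+t. (\<integral>\<^sup>+y. ennreal (t ^ (N - 1)) * ennreal (norm y ^ N) * indicator {0<..} t * f (t *\<^sub>R y) * indicator B y \<partial>lborel) \<partial>lborel)"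
    by (rule lborel_pair.Fubini') (simp)
  also have "\<dots> = (\<integral>\<^sup>+t. (\<integral>\<^sup>+x. (if norm x < t then ennreal (norm x ^ N / t ^ (N + 1)) else 0) * f x \<partial>lborel) \<partial>lborel)"
  proof (rule nn_integral_cong)
    fix t :: real
    show "(\<integral>\<^sup>+y. ennreal (t ^ (N - 1)) * ennreal (norm y ^ N) * indicator {0<..} t * f (t *\<^sub>R y) * indicator B y \<partial>lborel)
      = (\<integral>\<^sup>+x. (if norm x < t then ennreal (norm x ^ N / t ^ (N + 1)) else 0) * f x \<partial>lborel)"
    proof (cases "t > 0")
      case False
      then have "t \<le> norm (x::'a)" for x using norm_ge_zero[of x] by linarith
      then have "\<not> norm (x::'a) < t" for x by (simp add: not_less)
      with False show ?thesis by simp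
    next
      case True
      have "(\<integral>\<^sup>+x. (if norm x < t then ennreal (norm x ^ N / t ^ (N + 1)) else 0) * f x \<partial>lborel)
         = ennreal (t ^ N) * (\<integral>\<^sup>+y. (if norm (t *\<^sub>R y) < t then ennreal (norm (t *\<^sub>R y) ^ N / t ^ (N + 1)) else 0) * f (t *\<^sub>R y) \<partial>lborel)"
        unfolding N_def by (rule nn_integral_lborel_scaleR) (use True in simp_all)
      also have "\<dots> = (\<integral>\<^sup>+y. ennreal (t ^ N) * ((if norm (t *\<^sub>R y) < t then ennreal (norm (t *\<^sub>R y) ^ N / t ^ (N + 1)) else 0) * f (t *\<^sub>R y)) \<partial>lborel)"
        by (rule nn_integral_cmult[symmetric]) simp
      also have "\<dots> = (\<integral>\<^sup>+y. ennreal (t ^ (N - 1)) * ennreal (norm y ^ N) * indicator {0<..} t * f (t *\<^sub>R y) * indicator B y \<partial>lborel)"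
      proof (rule nn_integral_cong)
        fix y :: 'a
        have "norm (t *\<^sub>R y) < t \<longleftrightarrow> y \<in> B"
          using True by (simp add: B_def)
        moreover have "ennreal (t ^ N) * ennreal (norm (t *\<^sub>R y) ^ N / t ^ (N + 1)) = ennreal (t ^ (N - 1)) * ennreal (norm y ^ N)"
        proof -
          have "t ^ N * (norm (t *\<^sub>R y) ^ N / t ^ (N + 1)) = t ^ (N - 1) * norm y ^ N"
            using True N by (cases N) (simp_all add: power_mult_distrib field_simps)
          then show ?thesis using True by (simp flip: ennreal_mult)
        qed
        ultimately show "ennreal (t ^ N) * ((if norm (t *\<^sub>R y) < t then ennreal (norm (t *\<^sub>R y) ^ N / t ^ (N + 1)) else 0) * f (t *\<^sub>R y))
          = ennreal (t ^ (N - 1)) * ennreal (norm y ^ N) * indicator {0<..} t * f (t *\<^sub>R y) * indicator B y"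
          using True by (simp add: mult.assoc[symmetric])
      qed
      finally show ?thesis ..
    qed
  qed
  also have "\<dots> = (\<integral>\<^sup>+x. (\<integral>\<^sup>+t. (if norm x < t then ennreal (norm x ^ N / t ^ (N + 1)) else 0) * f x \<partial>lborel) \<partial>lborel)"
    by (rule lborel_pair.Fubini'[symmetric]) simp
  also have "ennreal N * \<dots> = (\<integral>\<^sup>+x. ennreal N * (\<integral>\<^sup>+t. (if norm x < t then ennreal (norm x ^ N / t ^ (N + 1)) else 0) * f x \<partial>lborel) \<partial>lborel)"
    by (rule nn_integral_cmult[symmetric]) simp
  also have "\<dots> = (\<integral>\<^sup>+x. f x \<partial>lborel)"
  proof (rule nn_integral_cong_AE)
    have "AE y in lborel. (y::'a) \<noteq> 0" using AE_lborel_singleton[of 0] by simp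
    then show "AE x in lborel. ennreal N * (\<integral>\<^sup>+t. (if norm x < t then ennreal (norm x ^ N / t ^ (N + 1)) else 0) * f x \<partial>lborel) = f x"
    proof eventually_elim
      fix x :: 'a assume "x \<noteq> 0"
      define a where "a = norm x"
      have a: "a > 0" using \<open>x \<noteq> 0\<close> by (simp add: a_def)
      have "(\<integral>\<^sup>+t. ennreal (N * a ^ N / t ^ (N + 1)) * indicator {a..} t \<partial>lborel) = ennreal (0 - (- (a ^ N / a ^ N)))"
      proof (rule nn_integral_FTC_atLeast[where F = "\<lambda>t. - (a ^ N / t ^ N)"])
        show "((\<lambda>t. - (a ^ N / t ^ N)) \<longlongrightarrow> 0) at_top"
        proof -
          have "((\<lambda>t::real. a ^ N * inverse (t ^ N)) \<longlongrightarrow> a ^ N * 0) at_top"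
            using N by (intro tendsto_mult tendsto_const tendsto_inverse_0_at_top
                filterlim_pow_at_top filterlim_ident) auto
          from tendsto_minus[OF this] show ?thesis by (simp add: divide_inverse)
        qed
        show "DERIV (\<lambda>t. - (a ^ N / t ^ N)) t :> N * a ^ N / t ^ (N + 1)" if "a \<le> t" for t
        proof -
          obtain M where M: "N = Suc M" using N by (cases N) auto
          have pow: "t * t ^ (k - Suc 0) = t ^ k" if "k \<noteq> 0" for k
            using that by (cases k) auto
          show ?thesis
            using that a unfolding M
            by (cases "M = 0") (auto intro!: derivative_eq_intros simp: field_simps power2_eq_square pow)
        qed
      qed (use a in auto)
      then have 1: "(\<integral>\<^sup>+t. ennreal (N * a ^ N / t ^ (N + 1)) * indicator {a..} t \<partial>lborel) = 1"
        using a by simp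
      have "ennreal N * (\<integral>\<^sup>+t. (if a < t then ennreal (a ^ N / t ^ (N + 1)) else 0) * f x \<partial>lborel)
         = ennreal N * (\<integral>\<^sup>+t. (if a < t then ennreal (a ^ N / t ^ (N + 1)) else 0) \<partial>lborel) * f x"
        by (simp add: nn_integral_multc mult.assoc)
      also have "ennreal N * (\<integral>\<^sup>+t. (if a < t then ennreal (a ^ N / t ^ (N + 1)) else 0) \<partial>lborel)
         = (\<integral>\<^sup>+t. ennreal N * ((if a < t then ennreal (a ^ N / t ^ (N + 1)) else 0)) \<partial>lborel)"
        by (rule nn_integral_cmult[symmetric]) simp
      also have "\<dots> = (\<integral>\<^sup>+t. ennreal (N * a ^ N / t ^ (N + 1)) * indicator {a..} t \<partial>lborel)"
      proof (rule nn_integral_cong_AE)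
        show "AE t in lborel. ennreal N * ((if a < t then ennreal (a ^ N / t ^ (N + 1)) else 0)) = ennreal (N * a ^ N / t ^ (N + 1)) * indicator {a..} t"
          using AE_lborel_singleton[of a]
          by eventually_elim (use a in \<open>auto simp: indicator_def simp flip: ennreal_mult\<close>)
      qed
      finally show "ennreal N * (\<integral>\<^sup>+t. (if norm x < t then ennreal (norm x ^ N / t ^ (N + 1)) else 0) * f x \<partial>lborel) = f x"
        unfolding a_def using 1 unfolding a_def by simp
    qed
  qed
  finally show ?thesis by (simp add: N_def \<beta>_def)
qed

section \<open>Spherical means seen from an interior point of the sphere\<close>

text \<open>Let \<open>|z| < s\<close> and \<open>|w| = 1\<close>. The ray from 0 in the direction \<open>w\<close> leaves the ball of radius \<open>s\<close>
about \<open>z\<close> at the distance \<open>\<rho> = x + D\<close>, where \<open>x = z \<bullet> w\<close> and \<open>D\<^sup>2 = x\<^sup>2 + s\<^sup>2 - |z|\<^sup>2\<close>. Indeed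
the equation \<open>|r w - z| = s\<close> reads \<open>r\<^sup>2 - 2 x r = s\<^sup>2 - |z|\<^sup>2\<close> and has the roots \<open>x \<plusminus> D\<close>, the
second of which is negative.\<close>

definition ray_disc :: "'a::euclidean_space \<Rightarrow> real \<Rightarrow> 'a \<Rightarrow> real" where
  "ray_disc z s w = sqrt ((z \<bullet> w)\<^sup>2 + (s\<^sup>2 - (norm z)\<^sup>2))"

definition ray_length :: "'a::euclidean_space \<Rightarrow> real \<Rightarrow> 'a \<Rightarrow> real" where
  "ray_length z s w = z \<bullet> w + ray_disc z s w"

lemma ray_disc_gt:
  assumes "norm z < s"
  shows "\<bar>z \<bullet> w\<bar> < ray_disc z s w"
proof -
  have "(norm z)\<^sup>2 < s\<^sup>2" using assms by (simp add: power_strict_mono)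
  then have "sqrt ((z \<bullet> w)\<^sup>2) < ray_disc z s w"
    unfolding ray_disc_def by (intro real_sqrt_less_mono) linarith
  then show ?thesis by simp
qed

lemma ray_disc_pos: "norm z < s \<Longrightarrow> 0 < ray_disc z s w"
  using ray_disc_gt[of z s w] by linarith

lemma ray_length_pos: "norm z < s \<Longrightarrow> 0 < ray_length z s w"
  using ray_disc_gt[of z s w] by (simp add: ray_length_def)

lemma ray_disc_sq:
  assumes "norm z < s"
  shows "(ray_disc z s w)\<^sup>2 = (z \<bullet> w)\<^sup>2 + (s\<^sup>2 - (norm z)\<^sup>2)"
proof -
  have "(norm z)\<^sup>2 < s\<^sup>2" using assms by (simp add: power_strict_mono)
  then show ?thesis by (simp add: ray_disc_def add_nonneg_nonneg)
qed

lemma norm_ray_point_sq: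
  assumes "norm w = 1"
  shows "(norm (r *\<^sub>R w - z))\<^sup>2 = (r - z \<bullet> w)\<^sup>2 - (z \<bullet> w)\<^sup>2 + (norm z)\<^sup>2"
proof -
  have ww: "w \<bullet> w = 1" using assms by (simp add: norm_eq_1)
  have "(norm (r *\<^sub>R w - z))\<^sup>2 = r\<^sup>2 * (w \<bullet> w) - 2 * r * (z \<bullet> w) + z \<bullet> z"
    unfolding power2_norm_eq_inner
    by (simp add: inner_diff_left inner_diff_right inner_commute power2_eq_square)
  moreover have "(norm z)\<^sup>2 = z \<bullet> z" by (rule power2_norm_eq_inner)
  ultimately show ?thesis
    by (simp add: ww power2_diff algebra_simps)
qed

lemma norm_ray_le_iff:
  assumes "norm w = 1" "norm z < s" "r > 0"
  shows "norm (r *\<^sub>R w - z) \<le> s \<longleftrightarrow> r \<le> ray_length z s w"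
    and "s \<le> norm (r *\<^sub>R w - z) \<longleftrightarrow> ray_length z s w \<le> r"
proof -
  define x where "x = z \<bullet> w"
  define D where "D = ray_disc z s w"
  have D: "\<bar>x\<bar> < D" "D\<^sup>2 = x\<^sup>2 + (s\<^sup>2 - (norm z)\<^sup>2)"
    using assms ray_disc_gt ray_disc_sq by (auto simp: x_def D_def)
  have s: "s \<ge> 0" using assms(2) norm_ge_zero[of z] by linarith
  have n: "(norm (r *\<^sub>R w - z))\<^sup>2 = (r - x)\<^sup>2 - x\<^sup>2 + (norm z)\<^sup>2"
    unfolding x_def by (rule norm_ray_point_sq[OF assms(1)])
  have "norm (r *\<^sub>R w - z) \<le> s \<longleftrightarrow> (norm (r *\<^sub>R w - z))\<^sup>2 \<le> s\<^sup>2"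
    using s by (simp add: power2_le_iff_abs_le)
  also have "\<dots> \<longleftrightarrow> (r - x)\<^sup>2 \<le> D\<^sup>2" unfolding n D(2) by linarith
  also have "\<dots> \<longleftrightarrow> \<bar>r - x\<bar> \<le> D" using D(1) by (simp add: power2_le_iff_abs_le)
  also have "\<dots> \<longleftrightarrow> r \<le> ray_length z s w"
    using D(1) assms(3) by (auto simp: ray_length_def D_def x_def)
  finally show "norm (r *\<^sub>R w - z) \<le> s \<longleftrightarrow> r \<le> ray_length z s w" .
  have "s \<le> norm (r *\<^sub>R w - z) \<longleftrightarrow> s\<^sup>2 \<le> (norm (r *\<^sub>R w - z))\<^sup>2"
    using s by (simp add: power_mono_iff)
  also have "\<dots> \<longleftrightarrow> D\<^sup>2 \<le> (r - x)\<^sup>2" unfolding n D(2) by linarith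
  also have "\<dots> \<longleftrightarrow> D \<le> \<bar>r - x\<bar>" using D by (metis abs_ge_zero abs_le_square_iff abs_of_nonneg abs_abs order.strict_implies_order order.strict_trans1)
  also have "\<dots> \<longleftrightarrow> ray_length z s w \<le> r"
    using D(1) assms(3) by (auto simp: ray_length_def D_def x_def)
  finally show "s \<le> norm (r *\<^sub>R w - z) \<longleftrightarrow> ray_length z s w \<le> r" .
qed

lemma ray_point_in_sphere:
  assumes "norm w = 1" "norm z < s"
  shows "ray_length z s w *\<^sub>R w \<in> sphere z s"
  using norm_ray_le_iff[OF assms ray_length_pos[OF assms(2)]]
  by (metis antisym dist_commute dist_norm mem_sphere order_refl)

lemma has_derivative_ray_length:
  assumes "norm z < s"
  shows "((\<lambda>s. ray_length z s w) has_real_derivative s / ray_disc z s w) (at s)"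
proof -
  have "0 < (z \<bullet> w)\<^sup>2 + (s\<^sup>2 - (norm z)\<^sup>2)"
    using ray_disc_pos[OF assms, of w] unfolding ray_disc_def real_sqrt_gt_0_iff .
  then show ?thesis
    unfolding ray_length_def ray_disc_def
    by (auto intro!: derivative_eq_intros simp: field_simps)
qed

lemma continuous_on_ray_disc [continuous_intros]:
  "continuous_on A f \<Longrightarrow> continuous_on A g \<Longrightarrow> continuous_on A (\<lambda>x. ray_disc z (f x) (g x))"
  unfolding ray_disc_def by (intro continuous_intros)

lemma continuous_on_ray_length [continuous_intros]:
  "continuous_on A f \<Longrightarrow> continuous_on A g \<Longrightarrow> continuous_on A (\<lambda>x. ray_length z (f x) (g x))"
  unfolding ray_length_def by (intro continuous_intros)

lemma measurable_ray_disc [measurable (raw)]: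
  assumes [measurable]: "f \<in> borel_measurable M" "g \<in> borel_measurable M"
  shows "(\<lambda>x. ray_disc z (f x) (g x)) \<in> borel_measurable M"
  unfolding ray_disc_def by measurable

lemma measurable_ray_length [measurable (raw)]:
  assumes [measurable]: "f \<in> borel_measurable M" "g \<in> borel_measurable M"
  shows "(\<lambda>x. ray_length z (f x) (g x)) \<in> borel_measurable M"
  unfolding ray_length_def by measurable

text \<open>The integral of \<open>f\<close> over the shell \<open>a \<le> |x - z| \<le> b\<close> in polar coordinates about \<open>z\<close> and about 0.
In the second case the radius is parametrized along each ray by the distance \<open>s\<close> from \<open>z\<close>,
whence the factor \<open>d\<rho>/ds = s / D\<close>.\<close>

lemma nn_integral_eccentric_shell:
  fixes f :: "'a::euclidean_space \<Rightarrow> ennreal"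
  assumes [measurable]: "f \<in> borel_measurable borel" and z: "norm z < a" and ab: "a < b"
  shows "(\<integral>\<^sup>+s. (\<integral>\<^sup>+w. ennreal (s ^ (DIM('a) - 1)) * f (z + s *\<^sub>R w) \<partial>unit_sphere_measure) * indicator {a..b} s \<partial>lborel) =
    (\<integral>\<^sup>+s. (\<integral>\<^sup>+w. ennreal (ray_length z s w ^ (DIM('a) - 1) * (s / ray_disc z s w)) * f (ray_length z s w *\<^sub>R w) \<partial>unit_sphere_measure) * indicator {a..b} s \<partial>lborel)"
proof -
  interpret mu: finite_measure "unit_sphere_measure :: 'a measure"
    by (rule finite_measure_normalized_sphere_measure)
  interpret P: pair_sigma_finite "unit_sphere_measure :: 'a measure" "lborel :: real measure" ..
  define N where "N = DIM('a) - 1"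
  define C where "C = ennreal DIM('a) * emeasure lborel (ball (0::'a) 1)"
  have C: "C \<noteq> 0" "C \<noteq> top"
    using emeasure_unit_ball_bounds[where 'a='a] by (auto simp: C_def ennreal_mult_eq_top_iff)
  have a0: "a > 0" using z norm_ge_zero[of z] by linarith
  define F where "F x = f x * (if a \<le> norm (x - z) \<and> norm (x - z) \<le> b then 1 else 0)" for x
  have [measurable]: "F \<in> borel_measurable borel" unfolding F_def by measurable
  have "C * (\<integral>\<^sup>+s. (\<integral>\<^sup>+w. ennreal (s ^ N) * f (z + s *\<^sub>R w) \<partial>unit_sphere_measure) * indicator {a..b} s \<partial>lborel)
     = C * (\<integral>\<^sup>+s. ennreal (s ^ N) * indicator {0<..} s * (\<integral>\<^sup>+w. F (z + s *\<^sub>R w) \<partial>unit_sphere_measure) \<partial>lborel)"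
  proof (intro arg_cong[where f = "\<lambda>x. C * x"] nn_integral_cong)
    fix s :: real
    have "(\<integral>\<^sup>+w. F (z + s *\<^sub>R w) \<partial>unit_sphere_measure) = (\<integral>\<^sup>+w. f (z + s *\<^sub>R w) \<partial>unit_sphere_measure) * indicator {a..b} s"
      if "s > 0"
    proof -
      have "(\<integral>\<^sup>+w. F (z + s *\<^sub>R w) \<partial>unit_sphere_measure) = (\<integral>\<^sup>+w. f (z + s *\<^sub>R w) * indicator {a..b} s \<partial>unit_sphere_measure)"
      proof (rule nn_integral_cong_AE)
        show "AE w in unit_sphere_measure. F (z + s *\<^sub>R w) = f (z + s *\<^sub>R w) * indicator {a..b} s"
          using AE_unit_sphere_measure by eventually_elim (use that in \<open>auto simp: F_def\<close>)
      qed
      also have "\<dots> = (\<integral>\<^sup>+w. f (z + s *\<^sub>R w) \<partial>unit_sphere_measure) * indicator {a..b} s"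
        by (rule nn_integral_multc) simp
      finally show ?thesis .
    qed
    moreover have "(\<integral>\<^sup>+w. ennreal (s ^ N) * f (z + s *\<^sub>R w) \<partial>unit_sphere_measure) = ennreal (s ^ N) * (\<integral>\<^sup>+w. f (z + s *\<^sub>R w) \<partial>unit_sphere_measure)"
      by (rule nn_integral_cmult) simp
    ultimately show "(\<integral>\<^sup>+w. ennreal (s ^ N) * f (z + s *\<^sub>R w) \<partial>unit_sphere_measure) * indicator {a..b} s
      = ennreal (s ^ N) * indicator {0<..} s * (\<integral>\<^sup>+w. F (z + s *\<^sub>R w) \<partial>unit_sphere_measure)"
      using a0 by (cases "s > 0") (simp_all add: mult.assoc)
  qed
  also have "\<dots> = (\<integral>\<^sup>+x. F (z + x) \<partial>lborel)"
    by (subst (2) nn_integral_polar) (simp_all add: C_def N_def)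
  also have "\<dots> = (\<integral>\<^sup>+x. F x \<partial>lborel)"
    by (rule nn_integral_lborel_translate) simp
  also have "\<dots> = C * (\<integral>\<^sup>+s. ennreal (s ^ N) * indicator {0<..} s * (\<integral>\<^sup>+w. F (s *\<^sub>R w) \<partial>unit_sphere_measure) \<partial>lborel)"
    by (subst nn_integral_polar) (simp_all add: C_def N_def)
  finally have "(\<integral>\<^sup>+s. (\<integral>\<^sup>+w. ennreal (s ^ N) * f (z + s *\<^sub>R w) \<partial>unit_sphere_measure) * indicator {a..b} s \<partial>lborel)
     = (\<integral>\<^sup>+s. ennreal (s ^ N) * indicator {0<..} s * (\<integral>\<^sup>+w. F (s *\<^sub>R w) \<partial>unit_sphere_measure) \<partial>lborel)"
    using C by (simp add: ennreal_mult_cancel_left)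
  also have "\<dots> = (\<integral>\<^sup>+s. (\<integral>\<^sup>+w. ennreal (s ^ N) * indicator {0<..} s * F (s *\<^sub>R w) \<partial>unit_sphere_measure) \<partial>lborel)"
    by (intro nn_integral_cong nn_integral_cmult[symmetric]) simp
  also have "\<dots> = (\<integral>\<^sup>+w. (\<integral>\<^sup>+s. ennreal (s ^ N) * indicator {0<..} s * F (s *\<^sub>R w) \<partial>lborel) \<partial>unit_sphere_measure)"
    by (rule P.Fubini') simp
  also have "\<dots> = (\<integral>\<^sup>+w. (\<integral>\<^sup>+s. ennreal (ray_length z s w ^ N * (s / ray_disc z s w)) * f (ray_length z s w *\<^sub>R w) * indicator {a..b} s \<partial>lborel) \<partial>unit_sphere_measure)"
  proof (rule nn_integral_cong_AE)
    show "AE w in unit_sphere_measure. (\<integral>\<^sup>+s. ennreal (s ^ N) * indicator {0<..} s * F (s *\<^sub>R w) \<partial>lborel)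
       = (\<integral>\<^sup>+s. ennreal (ray_length z s w ^ N * (s / ray_disc z s w)) * f (ray_length z s w *\<^sub>R w) * indicator {a..b} s \<partial>lborel)"
      using AE_unit_sphere_measure
    proof eventually_elim
      fix w :: 'a assume w: "norm w = 1"
      have zb: "norm z < b" using z ab by simp
      define g where "g s = ray_length z s w" for s
      have "(\<integral>\<^sup>+s. ennreal (s ^ N) * indicator {0<..} s * F (s *\<^sub>R w) \<partial>lborel)
         = (\<integral>\<^sup>+r. (ennreal (r ^ N) * f (r *\<^sub>R w)) * indicator {g a..g b} r \<partial>lborel)"
      proof (rule nn_integral_cong)
        fix r :: real
        have "g a > 0" using ray_length_pos[OF z] by (simp add: g_def)
        then show "ennreal (r ^ N) * indicator {0<..} r * F (r *\<^sub>R w) = (ennreal (r ^ N) * f (r *\<^sub>R w)) * indicator {g a..g b} r"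
          using norm_ray_le_iff[OF w zb, of r] norm_ray_le_iff[OF w z, of r]
          by (cases "r > 0") (auto simp: F_def g_def indicator_def)
      qed
      also have "\<dots> = (\<integral>\<^sup>+s. (ennreal (g s ^ N) * f (g s *\<^sub>R w)) * ennreal (s / ray_disc z s w) * indicator {a..b} s \<partial>lborel)"
      proof (rule nn_integral_substitution_aux)
        show "(g has_real_derivative s / ray_disc z s w) (at s)" if "s \<in> {a..b}" for s
          unfolding g_def[abs_def] using that z by (intro has_derivative_ray_length) auto
        show "continuous_on {a..b} (\<lambda>s. s / ray_disc z s w)"
          using z ray_disc_pos[of z _ w] by (intro continuous_intros ballI) (smt (verit) atLeastAtMost_iff)
        show "0 \<le> s / ray_disc z s w" if "s \<in> {a..b}" for s
          using that a0 ray_disc_pos[of z s w] z by simp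
      qed (use ab in auto)
      also have "\<dots> = (\<integral>\<^sup>+s. ennreal (ray_length z s w ^ N * (s / ray_disc z s w)) * f (ray_length z s w *\<^sub>R w) * indicator {a..b} s \<partial>lborel)"
      proof (rule nn_integral_cong)
        fix s :: real
        show "(ennreal (g s ^ N) * f (g s *\<^sub>R w)) * ennreal (s / ray_disc z s w) * indicator {a..b} s
           = ennreal (ray_length z s w ^ N * (s / ray_disc z s w)) * f (ray_length z s w *\<^sub>R w) * indicator {a..b} s"
        proof (cases "s \<in> {a..b}")
          case True
          then have zs: "norm z < s" using z by auto
          have "0 \<le> s / ray_disc z s w" using True a0 ray_disc_pos[OF zs, of w] by simp
          then show ?thesis using ray_length_pos[OF zs, of w]
            by (subst ennreal_mult) (simp_all add: g_def mult_ac)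
        qed simp
      qed
      finally show "(\<integral>\<^sup>+s. ennreal (s ^ N) * indicator {0<..} s * F (s *\<^sub>R w) \<partial>lborel)
        = (\<integral>\<^sup>+s. ennreal (ray_length z s w ^ N * (s / ray_disc z s w)) * f (ray_length z s w *\<^sub>R w) * indicator {a..b} s \<partial>lborel)" .
    qed
  qed
  also have "\<dots> = (\<integral>\<^sup>+s. (\<integral>\<^sup>+w. ennreal (ray_length z s w ^ N * (s / ray_disc z s w)) * f (ray_length z s w *\<^sub>R w) * indicator {a..b} s \<partial>unit_sphere_measure) \<partial>lborel)"
    by (rule P.Fubini'[symmetric]) simp
  also have "\<dots> = (\<integral>\<^sup>+s. (\<integral>\<^sup>+w. ennreal (ray_length z s w ^ N * (s / ray_disc z s w)) * f (ray_length z s w *\<^sub>R w) \<partial>unit_sphere_measure) * indicator {a..b} s \<partial>lborel)"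
    by (intro nn_integral_cong nn_integral_multc) simp
  finally show ?thesis by (simp add: N_def)
qed

lemma continuous_on_sphere_integral:
  fixes F :: "real \<Rightarrow> 'a::euclidean_space \<Rightarrow> real"
  assumes "continuous_on ({a..b} \<times> UNIV) (\<lambda>(s, w). F s w)"
  shows "continuous_on {a..b} (\<lambda>s. LINT w|unit_sphere_measure. F s w)"
proof -
  interpret mu: finite_measure "unit_sphere_measure :: 'a measure"
    by (rule finite_measure_normalized_sphere_measure)
  have "compact ((\<lambda>(s, w). F s w) ` ({a..b} \<times> sphere 0 1))"
    by (intro compact_continuous_image continuous_on_subset[OF assms] compact_Times) auto
  then obtain B where B: "\<And>s w. s \<in> {a..b} \<Longrightarrow> w \<in> sphere 0 1 \<Longrightarrow> norm (F s w) \<le> B"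
    unfolding compact_eq_bounded_closed bounded_iff by (metis (no_types, lifting) case_prod_conv image_eqI mem_Sigma_iff)
  have cw: "continuous_on UNIV (F s)" if "s \<in> {a..b}" for s
  proof -
    have "continuous_on UNIV ((\<lambda>(s, w). F s w) \<circ> (\<lambda>w. (s, w)))"
      using that by (intro continuous_on_compose continuous_on_subset[OF assms] continuous_intros) auto
    then show ?thesis by (simp add: comp_def)
  qed
  have cs: "continuous_on {a..b} (\<lambda>s. F s w)" for w
  proof -
    have "continuous_on {a..b} ((\<lambda>(s, w). F s w) \<circ> (\<lambda>s. (s, w)))"
      by (intro continuous_on_compose continuous_on_subset[OF assms] continuous_intros) auto
    then show ?thesis by (simp add: comp_def)
  qed
  show ?thesis
    unfolding continuous_on_sequentially comp_def
  proof safe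
    fix x :: "nat \<Rightarrow> real" and s assume s: "s \<in> {a..b}" and x: "\<forall>n. x n \<in> {a..b}" "x \<longlonglongrightarrow> s"
    show "(\<lambda>n. LINT w|unit_sphere_measure. F (x n) w) \<longlonglongrightarrow> (LINT w|unit_sphere_measure. F s w)"
    proof (rule integral_dominated_convergence)
      show "F s \<in> borel_measurable unit_sphere_measure" "F (x n) \<in> borel_measurable unit_sphere_measure" for n
        using cw[OF s] cw[of "x n"] x by (auto intro!: borel_measurable_continuous_onI)
      show "integrable unit_sphere_measure (\<lambda>w::'a. B)" by simp
      show "AE w in unit_sphere_measure. (\<lambda>n. F (x n) w) \<longlonglongrightarrow> F s w"
        using cs x s unfolding continuous_on_sequentially comp_def by (intro AE_I2) blast
      show "AE w in unit_sphere_measure. norm (F (x n) w) \<le> B" for n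
        using AE_unit_sphere_measure by eventually_elim (use B x in auto)
    qed
  qed
qed

text \<open>Both sides are continuous in \<open>s\<close>, and their integrals over all short intervals agree by the
comparison of shells; differentiating the integrals with respect to the upper limit gives the
identity for each single \<open>s\<close>.\<close>

lemma eccentric_mean_nonneg:
  fixes f :: "'a::euclidean_space \<Rightarrow> real"
  assumes f: "continuous_on UNIV f" "\<And>x. f x \<ge> 0" and z: "norm z < s"
  shows "s ^ (DIM('a) - 1) * (LINT w|unit_sphere_measure. f (z + s *\<^sub>R w)) =
    (LINT w|unit_sphere_measure. ray_length z s w ^ (DIM('a) - 1) * (s / ray_disc z s w) * f (ray_length z s w *\<^sub>R w))"
proof -
  define a where "a = (norm z + s) / 2"
  define b where "b = s + 1"
  have ab: "norm z < a" "a < s" "s < b" "a < b" "0 < a"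
    using z le_less_trans[OF norm_ge_zero z] by (auto simp: a_def b_def add_nonneg_pos)
  define A where "A t w = t ^ (DIM('a) - 1) * f (z + t *\<^sub>R w)" for t w
  define B where "B t w = ray_length z t w ^ (DIM('a) - 1) * (t / ray_disc z t w) * f (ray_length z t w *\<^sub>R w)" for t w
  have fc: "continuous_on S g \<Longrightarrow> continuous_on S (\<lambda>x. f (g x))" for S and g :: "real \<times> 'a \<Rightarrow> 'a"
    by (rule continuous_on_compose2[OF f(1)]) auto
  have cA: "continuous_on ({a..b} \<times> UNIV) (\<lambda>(t, w). A t w)"
    unfolding A_def split_beta by (intro continuous_intros fc)
  have cB: "continuous_on ({a..b} \<times> UNIV) (\<lambda>(t, w). B t w)"
    unfolding B_def split_beta
  proof (intro continuous_intros fc ballI)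
    fix x :: "real \<times> 'a" assume "x \<in> {a..b} \<times> UNIV"
    then show "ray_disc z (fst x) (snd x) \<noteq> 0"
      using ray_disc_pos[of z "fst x" "snd x"] ab by auto
  qed
  define \<phi> where "\<phi> t = (LINT w|unit_sphere_measure. A t w)" for t
  define \<psi> where "\<psi> t = (LINT w|unit_sphere_measure. B t w)" for t
  have c\<phi>: "continuous_on {a..b} \<phi>" unfolding \<phi>_def by (rule continuous_on_sphere_integral[OF cA])
  have c\<psi>: "continuous_on {a..b} \<psi>" unfolding \<psi>_def by (rule continuous_on_sphere_integral[OF cB])
  have slice: "continuous_on UNIV (G t)" if "continuous_on ({a..b} \<times> UNIV) (\<lambda>(t, w). G t w)" "t \<in> {a..b}"
    for G :: "real \<Rightarrow> 'a \<Rightarrow> real" and t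
  proof -
    have "continuous_on UNIV ((\<lambda>(t, w). G t w) \<circ> (\<lambda>w. (t, w)))"
      using that(2) by (intro continuous_on_compose continuous_on_subset[OF that(1)] continuous_intros) auto
    then show ?thesis by (simp add: comp_def)
  qed
  have nnA: "A t w \<ge> 0" and nnB: "B t w \<ge> 0" if "t \<in> {a..b}" for t w
    using that ab f(2) ray_disc_pos[of z t w] ray_length_pos[of z t w] by (auto simp: A_def B_def)
  have nA: "(\<integral>\<^sup>+w. ennreal (A t w) \<partial>unit_sphere_measure) = ennreal (\<phi> t)"
   and nB: "(\<integral>\<^sup>+w. ennreal (B t w) \<partial>unit_sphere_measure) = ennreal (\<psi> t)" if t: "t \<in> {a..b}" for t
    unfolding \<phi>_def \<psi>_def using nnA[OF t] nnB[OF t]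
    by (intro nn_integral_eq_integral integrable_unit_sphere_measure slice[OF cA t] slice[OF cB t] AE_I2; simp)+
  have pos: "\<phi> t \<ge> 0" "\<psi> t \<ge> 0" if "t \<in> {a..b}" for t
    unfolding \<phi>_def \<psi>_def using nnA[OF that] nnB[OF that] by (auto intro!: integral_nonneg_AE AE_I2)
  have eq: "integral {a..t} \<phi> = integral {a..t} \<psi>" if t: "t \<in> {a<..b}" for t
  proof -
    have sub: "{a..t} \<subseteq> {a..b}" using t by auto
    have 1: "set_integrable lborel {a..t} \<phi>" "set_integrable lborel {a..t} \<psi>"
      using continuous_on_subset[OF c\<phi> sub] continuous_on_subset[OF c\<psi> sub]
      by (auto intro: borel_integrable_atLeastAtMost')
    have [measurable]: "f \<in> borel_measurable borel" using f(1) by (rule borel_measurable_continuous_onI)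
    have "(\<integral>\<^sup>+u. ennreal (indicator {a..t} u * \<phi> u) \<partial>lborel) = 
       (\<integral>\<^sup>+s. (\<integral>\<^sup>+w. ennreal (s ^ (DIM('a) - 1)) * ennreal (f (z + s *\<^sub>R w)) \<partial>unit_sphere_measure) * indicator {a..t} s \<partial>lborel)"
    proof (rule nn_integral_cong)
      fix u :: real
      show "ennreal (indicator {a..t} u * \<phi> u) = (\<integral>\<^sup>+w. ennreal (u ^ (DIM('a) - 1)) * ennreal (f (z + u *\<^sub>R w)) \<partial>unit_sphere_measure) * indicator {a..t} u"
      proof (cases "u \<in> {a..t}")
        case True
        with sub have u: "u \<in> {a..b}" by auto
        with ab have "u \<ge> 0" by auto
        then show ?thesis using True nA[OF u] f(2) by (simp add: A_def ennreal_mult)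
      qed simp
    qed
    also have "\<dots> = (\<integral>\<^sup>+s. (\<integral>\<^sup>+w. ennreal (ray_length z s w ^ (DIM('a) - 1) * (s / ray_disc z s w)) * ennreal (f (ray_length z s w *\<^sub>R w)) \<partial>unit_sphere_measure) * indicator {a..t} s \<partial>lborel)"
      by (rule nn_integral_eccentric_shell) (use ab t in auto)
    also have "\<dots> = (\<integral>\<^sup>+u. ennreal (indicator {a..t} u * \<psi> u) \<partial>lborel)"
    proof (rule nn_integral_cong)
      fix u :: real
      show "(\<integral>\<^sup>+w. ennreal (ray_length z u w ^ (DIM('a) - 1) * (u / ray_disc z u w)) * ennreal (f (ray_length z u w *\<^sub>R w)) \<partial>unit_sphere_measure) * indicator {a..t} u = ennreal (indicator {a..t} u * \<psi> u)"
      proof (cases "u \<in> {a..t}")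
        case True
        with sub have u: "u \<in> {a..b}" by auto
        with ab have u0: "u \<ge> 0" "norm z < u" by auto
        have "0 \<le> ray_length z u w ^ (DIM('a) - 1) * (u / ray_disc z u w)" for w
          using u0 ray_disc_pos[of z u w] ray_length_pos[of z u w] by simp
        then show ?thesis using True nB[OF u] f(2) by (simp add: B_def flip: ennreal_mult)
      qed simp
    qed
    finally have "ennreal (LINT u|lborel. indicator {a..t} u * \<phi> u) = ennreal (LINT u|lborel. indicator {a..t} u * \<psi> u)"
      using 1 pos sub unfolding set_integrable_def
      by (subst (asm) (1 2) nn_integral_eq_integral) (auto simp: indicator_def)
    then have "(LINT u|lborel. indicator {a..t} u * \<phi> u) = (LINT u|lborel. indicator {a..t} u * \<psi> u)"
      using pos sub by (subst (asm) ennreal_inj) (auto intro!: integral_nonneg_AE AE_I2 simp: indicator_def)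
    then show ?thesis
      using set_borel_integral_eq_integral(2)[OF 1(1)] set_borel_integral_eq_integral(2)[OF 1(2)]
      by (simp add: set_lebesgue_integral_def)
  qed
  have s_in: "s \<in> {a..b}" "s \<in> {a<..<b}" using ab by auto
  have at: "at s within {a..b} = at s" using ab by (simp add: at_within_Icc_at)
  have d1: "((\<lambda>t. integral {a..t} \<phi>) has_real_derivative \<phi> s) (at s)"
    using integral_has_real_derivative[OF c\<phi> s_in(1)] by (simp add: at)
  have d2: "((\<lambda>t. integral {a..t} \<psi>) has_real_derivative \<psi> s) (at s)"
    using integral_has_real_derivative[OF c\<psi> s_in(1)] by (simp add: at)
  have "((\<lambda>t. integral {a..t} \<phi>) has_real_derivative \<psi> s) (at s)"
    by (rule has_field_derivative_transform_within_open[OF d2 open_greaterThanLessThan s_in(2)]) (use eq in auto)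
  with d1 have "\<phi> s = \<psi> s" by (rule DERIV_unique)
  then show ?thesis by (simp add: \<phi>_def \<psi>_def A_def B_def)
qed

lemma eccentric_mean_real:
  fixes f :: "'a::euclidean_space \<Rightarrow> real"
  assumes f: "continuous_on UNIV f" and z: "norm z < s"
  shows "s ^ (DIM('a) - 1) * (LINT w|unit_sphere_measure. f (z + s *\<^sub>R w)) =
    (LINT w|unit_sphere_measure. ray_length z s w ^ (DIM('a) - 1) * (s / ray_disc z s w) * f (ray_length z s w *\<^sub>R w))"
proof -
  define p where "p x = max (f x) 0" for x
  define m where "m x = max (- f x) 0" for x
  have pm: "f x = p x - m x" for x by (simp add: p_def m_def)
  have c: "continuous_on UNIV p" "continuous_on UNIV m"
    unfolding p_def m_def using f by (auto intro!: continuous_intros)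
  have D: "ray_disc z s w \<noteq> 0" for w using ray_disc_pos[OF z] by (metis less_irrefl)
  have L: "integrable unit_sphere_measure (\<lambda>w. h (z + s *\<^sub>R w))"
    and R: "integrable unit_sphere_measure (\<lambda>w. ray_length z s w ^ (DIM('a) - 1) * (s / ray_disc z s w) * h (ray_length z s w *\<^sub>R w))"
    if "continuous_on UNIV h" for h :: "'a \<Rightarrow> real"
    using D by (intro integrable_unit_sphere_measure continuous_intros continuous_on_compose2[OF that]; simp)+
  show ?thesis
    unfolding pm right_diff_distrib
    using c L R eccentric_mean_nonneg[OF c(1) _ z] eccentric_mean_nonneg[OF c(2) _ z]
    by (simp add: p_def[symmetric] m_def[symmetric] right_diff_distrib) (simp add: p_def m_def)
qed

text \<open>The function only matters on the sphere, so that by Tietze's theorem it may be assumed to be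
continuous on the whole space. It is used below for functions with a singularity at 0.\<close>

theorem eccentric_mean:
  fixes f :: "'a::euclidean_space \<Rightarrow> complex"
  assumes f: "continuous_on (sphere z s) f" "f \<in> borel_measurable borel" and z: "norm z < s"
  shows "of_real (s ^ (DIM('a) - 1)) * (LINT w|unit_sphere_measure. f (z + s *\<^sub>R w)) =
    (LINT w|unit_sphere_measure. of_real (ray_length z s w ^ (DIM('a) - 1) * (s / ray_disc z s w)) * f (ray_length z s w *\<^sub>R w))"
proof -
  note [measurable] = f(2)
  obtain g :: "'a \<Rightarrow> complex" where g: "continuous_on UNIV g" "\<And>x. x \<in> sphere z s \<Longrightarrow> g x = f x"
    using Tietze_unbounded[OF f(1), of UNIV] by (metis closedin_closed_eq closed_UNIV closed_sphere subset_UNIV)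
  have [measurable]: "g \<in> borel_measurable borel" using g(1) by (rule borel_measurable_continuous_onI)
  have s: "s > 0" using le_less_trans[OF norm_ge_zero z] .
  have D: "ray_disc z s w \<noteq> 0" for w using ray_disc_pos[OF z] by (metis less_irrefl)
  have [measurable]: "(\<lambda>w. ray_disc z s w) \<in> borel_measurable borel" "(\<lambda>w. ray_length z s w) \<in> borel_measurable borel"
    by measurable
  have 1: "(LINT w|unit_sphere_measure. f (z + s *\<^sub>R w)) = (LINT w|unit_sphere_measure. g (z + s *\<^sub>R w))"
  proof (rule integral_cong_AE)
    show "AE w in unit_sphere_measure. f (z + s *\<^sub>R w) = g (z + s *\<^sub>R w)"
      using AE_unit_sphere_measure
    proof eventually_elim
      fix w :: 'a assume "norm w = 1"
      then have "z + s *\<^sub>R w \<in> sphere z s" using s by (simp add: dist_norm)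
      then show "f (z + s *\<^sub>R w) = g (z + s *\<^sub>R w)" by (simp only: g(2))
    qed
  qed measurable
  have 2: "(LINT w|unit_sphere_measure. of_real (ray_length z s w ^ (DIM('a) - 1) * (s / ray_disc z s w)) * f (ray_length z s w *\<^sub>R w))
    = (LINT w|unit_sphere_measure. of_real (ray_length z s w ^ (DIM('a) - 1) * (s / ray_disc z s w)) * g (ray_length z s w *\<^sub>R w))"
  proof (rule integral_cong_AE)
    show "AE w in unit_sphere_measure. of_real (ray_length z s w ^ (DIM('a) - 1) * (s / ray_disc z s w)) * f (ray_length z s w *\<^sub>R w)
       = of_real (ray_length z s w ^ (DIM('a) - 1) * (s / ray_disc z s w)) * g (ray_length z s w *\<^sub>R w)"
      using AE_unit_sphere_measure
      by eventually_elim (simp only: g(2)[OF ray_point_in_sphere[OF _ z]])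
  qed measurable
  have L: "integrable unit_sphere_measure (\<lambda>w. g (z + s *\<^sub>R w))"
    and R: "integrable unit_sphere_measure (\<lambda>w. of_real (ray_length z s w ^ (DIM('a) - 1) * (s / ray_disc z s w)) * g (ray_length z s w *\<^sub>R w))"
    using D by (intro integrable_unit_sphere_measure continuous_intros continuous_on_compose2[OF g(1)]; simp)+
  have c: "continuous_on UNIV (\<lambda>x. Re (g x))" "continuous_on UNIV (\<lambda>x. Im (g x))"
    using g(1) by (auto intro!: continuous_intros)
  show ?thesis
    unfolding 1 2
  proof (rule complex_eqI)
    show "Re (of_real (s ^ (DIM('a) - 1)) * (LINT w|unit_sphere_measure. g (z + s *\<^sub>R w))) =
      Re (LINT w|unit_sphere_measure. of_real (ray_length z s w ^ (DIM('a) - 1) * (s / ray_disc z s w)) * g (ray_length z s w *\<^sub>R w))"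
      unfolding integral_Re[OF R, symmetric]
      using eccentric_mean_real[OF c(1) z] integral_Re[OF L] by simp
    show "Im (of_real (s ^ (DIM('a) - 1)) * (LINT w|unit_sphere_measure. g (z + s *\<^sub>R w))) =
      Im (LINT w|unit_sphere_measure. of_real (ray_length z s w ^ (DIM('a) - 1) * (s / ray_disc z s w)) * g (ray_length z s w *\<^sub>R w))"
      unfolding integral_Im[OF R, symmetric]
      using eccentric_mean_real[OF c(2) z] integral_Im[OF L] by simp
  qed
qed

section \<open>Polynomial functions, partial derivatives and homogeneity\<close>

text \<open>Complex-valued polynomial functions on a real vector space, in the form that is needed here: a class
of smooth functions that contains all real-linear functionals and is closed under products and under
partial derivatives.\<close>

inductive complex_polynomial :: "('a::euclidean_space \<Rightarrow> complex) \<Rightarrow> bool" where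
  complex_polynomial_const: "complex_polynomial (\<lambda>x. c)"
| complex_polynomial_linear: "bounded_linear l \<Longrightarrow> complex_polynomial l"
| complex_polynomial_add: "complex_polynomial f \<Longrightarrow> complex_polynomial g \<Longrightarrow> complex_polynomial (\<lambda>x. f x + g x)"
| complex_polynomial_mult: "complex_polynomial f \<Longrightarrow> complex_polynomial g \<Longrightarrow> complex_polynomial (\<lambda>x. f x * g x)"

lemma complex_polynomial_sum:
  "(\<And>i. i \<in> I \<Longrightarrow> complex_polynomial (f i)) \<Longrightarrow> complex_polynomial (\<lambda>x. \<Sum>i\<in>I. f i x)"
  by (induction I rule: infinite_finite_induct)
     (auto intro: complex_polynomial_const complex_polynomial_add)

lemma complex_polynomial_prod:
  "(\<And>i. i \<in> I \<Longrightarrow> complex_polynomial (f i)) \<Longrightarrow> complex_polynomial (\<lambda>x. \<Prod>i\<in>I. f i x)"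
  by (induction I rule: infinite_finite_induct)
     (auto intro: complex_polynomial_const complex_polynomial_mult)

lemma complex_polynomial_power:
  "complex_polynomial f \<Longrightarrow> complex_polynomial (\<lambda>x. f x ^ k)"
  by (induction k) (auto intro: complex_polynomial_const complex_polynomial_mult)

lemma partial_deriv_eqI:
  assumes "(f has_derivative f') (at x)"
  shows "partial_deriv h f x = f' h"
proof -
  interpret bounded_linear f' using assms by (rule has_derivative_bounded_linear)
  have "((\<lambda>t. x + t *\<^sub>R h) has_derivative (\<lambda>t. t *\<^sub>R h)) (at 0)"
    by (auto intro!: derivative_eq_intros)
  moreover have "(f has_derivative f') (at (x + 0 *\<^sub>R h))" using assms by simp
  ultimately have "((\<lambda>t. f (x + t *\<^sub>R h)) has_derivative (\<lambda>t. f' (t *\<^sub>R h))) (at 0)"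
    by (rule has_derivative_compose)
  then have "((\<lambda>t. f (x + t *\<^sub>R h)) has_vector_derivative f' h) (at 0)"
    by (simp add: has_vector_derivative_def scaleR)
  then show ?thesis unfolding partial_deriv_def by (rule vector_derivative_at)
qed

lemma complex_polynomial_derivative_ex:
  "complex_polynomial f \<Longrightarrow>
    \<exists>f'. (\<forall>x. (f has_derivative f' x) (at x)) \<and> (\<forall>h. complex_polynomial (\<lambda>x. f' x h))"
proof (induction rule: complex_polynomial.induct)
  case (complex_polynomial_const c)
  then show ?case
    by (intro exI[of _ "\<lambda>x h. 0"]) (auto intro: complex_polynomial.intros)
next
  case (complex_polynomial_linear l)
  then show ?case
    by (intro exI[of _ "\<lambda>x. l"])
       (auto intro: complex_polynomial.intros bounded_linear_imp_has_derivative)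
next
  case (complex_polynomial_add f g)
  then obtain f' g' where
    "\<forall>x. (f has_derivative f' x) (at x)" "\<forall>h. complex_polynomial (\<lambda>x. f' x h)"
    "\<forall>x. (g has_derivative g' x) (at x)" "\<forall>h. complex_polynomial (\<lambda>x. g' x h)" by blast
  then show ?case
    by (intro exI[of _ "\<lambda>x h. f' x h + g' x h"])
       (auto intro: complex_polynomial.intros has_derivative_add)
next
  case (complex_polynomial_mult f g)
  then obtain f' g' where
    "\<forall>x. (f has_derivative f' x) (at x)" "\<forall>h. complex_polynomial (\<lambda>x. f' x h)"
    "\<forall>x. (g has_derivative g' x) (at x)" "\<forall>h. complex_polynomial (\<lambda>x. g' x h)" by blast
  with complex_polynomial_mult show ?case
    by (intro exI[of _ "\<lambda>x h. f x * g' x h + f' x h * g x"])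
       (auto intro!: complex_polynomial.complex_polynomial_add
          complex_polynomial.complex_polynomial_mult has_derivative_mult)
qed

lemma complex_polynomial_has_derivative:
  assumes "complex_polynomial f"
  shows "(f has_derivative (\<lambda>h. partial_deriv h f x)) (at x)"
proof -
  obtain f' where f': "\<And>x. (f has_derivative f' x) (at x)"
    using complex_polynomial_derivative_ex[OF assms] by blast
  have "(\<lambda>h. partial_deriv h f x) = f' x"
    using partial_deriv_eqI[OF f'] by blast
  then show ?thesis using f' by simp
qed

lemma complex_polynomial_partial_deriv:
  assumes "complex_polynomial f"
  shows "complex_polynomial (partial_deriv h f)"
proof -
  obtain f' where f': "\<And>x. (f has_derivative f' x) (at x)" "complex_polynomial (\<lambda>x. f' x h)"
    using complex_polynomial_derivative_ex[OF assms] by blast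
  have "partial_deriv h f = (\<lambda>x. f' x h)"
    using partial_deriv_eqI[OF f'(1)] by blast
  then show ?thesis using f' by simp
qed

lemma complex_polynomial_continuous_on:
  "complex_polynomial f \<Longrightarrow> continuous_on A f"
  by (meson complex_polynomial_has_derivative continuous_at_imp_continuous_on has_derivative_continuous)

lemma complex_polynomial_integrable:
  "complex_polynomial f \<Longrightarrow> integrable unit_sphere_measure f"
  by (intro integrable_unit_sphere_measure complex_polynomial_continuous_on)

lemma partial_deriv_const: "partial_deriv h (\<lambda>x. c) = (\<lambda>x. 0)"
  by (rule ext, rule partial_deriv_eqI) simp

lemma partial_deriv_linear: "bounded_linear l \<Longrightarrow> partial_deriv h l = (\<lambda>x. l h)"
  by (rule ext, rule partial_deriv_eqI) (rule bounded_linear_imp_has_derivative)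

lemma partial_deriv_add:
  assumes "complex_polynomial f" "complex_polynomial g"
  shows "partial_deriv h (\<lambda>x. f x + g x) = (\<lambda>x. partial_deriv h f x + partial_deriv h g x)"
proof
  fix x
  show "partial_deriv h (\<lambda>x. f x + g x) x = partial_deriv h f x + partial_deriv h g x"
    using partial_deriv_eqI[OF has_derivative_add[OF complex_polynomial_has_derivative[OF assms(1), of x]
          complex_polynomial_has_derivative[OF assms(2)]]] .
qed

lemma partial_deriv_mult:
  assumes "complex_polynomial f" "complex_polynomial g"
  shows "partial_deriv h (\<lambda>x. f x * g x) = (\<lambda>x. f x * partial_deriv h g x + partial_deriv h f x * g x)"
proof
  fix x
  show "partial_deriv h (\<lambda>x. f x * g x) x = f x * partial_deriv h g x + partial_deriv h f x * g x"
    using partial_deriv_eqI[OF has_derivative_mult[OF complex_polynomial_has_derivative[OF assms(1), of x]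
          complex_polynomial_has_derivative[OF assms(2)]]] .
qed

lemma partial_deriv_sum:
  assumes "\<And>i. i \<in> I \<Longrightarrow> complex_polynomial (f i)"
  shows "partial_deriv h (\<lambda>x. \<Sum>i\<in>I. f i x) = (\<lambda>x. \<Sum>i\<in>I. partial_deriv h (f i) x)"
  using assms
  by (induction I rule: infinite_finite_induct)
     (auto simp: partial_deriv_const partial_deriv_add complex_polynomial_sum)

lemma partial_deriv_basis_expansion:
  assumes "complex_polynomial f"
  shows "partial_deriv h f x = (\<Sum>b\<in>Basis. of_real (h \<bullet> b) * partial_deriv b f x)"
proof -
  interpret L: bounded_linear "\<lambda>h. partial_deriv h f x"
    using complex_polynomial_has_derivative[OF assms] by (rule has_derivative_bounded_linear)
  have "partial_deriv h f x = partial_deriv (\<Sum>b\<in>Basis. (h \<bullet> b) *\<^sub>R b) f x"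
    by (simp add: euclidean_representation)
  also have "\<dots> = (\<Sum>b\<in>Basis. of_real (h \<bullet> b) * partial_deriv b f x)"
    by (simp add: L.sum L.scaleR scaleR_conv_of_real)
  finally show ?thesis .
qed

lemma partial_deriv_commute:
  "complex_polynomial f \<Longrightarrow> partial_deriv a (partial_deriv b f) = partial_deriv b (partial_deriv a f)"
proof (induction rule: complex_polynomial.induct)
  case (complex_polynomial_mult f g)
  then show ?case
    by (simp add: partial_deriv_mult partial_deriv_add complex_polynomial_partial_deriv
        complex_polynomial.complex_polynomial_mult algebra_simps)
next
  case (complex_polynomial_add f g)
  then show ?case
    by (simp add: partial_deriv_add complex_polynomial_partial_deriv)
qed (simp_all add: partial_deriv_const partial_deriv_linear)

definition homogeneous :: "nat \<Rightarrow> ('a::real_vector \<Rightarrow> complex) \<Rightarrow> bool" where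
  "homogeneous d f \<longleftrightarrow> (\<forall>t x. f (t *\<^sub>R x) = of_real t ^ d * f x)"

lemma homogeneous_mult:
  "homogeneous d f \<Longrightarrow> homogeneous e g \<Longrightarrow> homogeneous (d + e) (\<lambda>x. f x * g x)"
  by (simp add: homogeneous_def power_add mult_ac)

lemma homogeneous_0_eq_const:
  assumes "homogeneous 0 f"
  shows "f = (\<lambda>x. f 0)"
proof
  fix x
  have "f (0 *\<^sub>R x) = of_real 0 ^ 0 * f x" using assms unfolding homogeneous_def by blast
  then show "f x = f 0" by simp
qed

lemma homogeneous_partial_deriv:
  assumes f: "complex_polynomial f" "homogeneous (Suc d) f"
  shows "homogeneous d (partial_deriv h f)"
proof -
  have nz: "partial_deriv h f (t *\<^sub>R x) = of_real t ^ d * partial_deriv h f x" if "t \<noteq> 0" for t x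
  proof -
    have d1: "((\<lambda>x. f (t *\<^sub>R x)) has_derivative (\<lambda>h. partial_deriv (t *\<^sub>R h) f (t *\<^sub>R x))) (at x)"
      by (rule has_derivative_compose[OF _ complex_polynomial_has_derivative[OF f(1)], of "\<lambda>x. t *\<^sub>R x"])
         (auto intro!: derivative_eq_intros)
    have d2: "((\<lambda>x. of_real t ^ Suc d * f x) has_derivative (\<lambda>h. of_real t ^ Suc d * partial_deriv h f x)) (at x)"
      by (intro has_derivative_mult_right complex_polynomial_has_derivative f)
    have eq: "(\<lambda>x. f (t *\<^sub>R x)) = (\<lambda>x. of_real t ^ Suc d * f x)"
      using f(2) by (simp add: homogeneous_def)
    interpret L: bounded_linear "\<lambda>h. partial_deriv h f (t *\<^sub>R x)"
      using complex_polynomial_has_derivative[OF f(1)] by (rule has_derivative_bounded_linear)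
    have "partial_deriv (t *\<^sub>R h) f (t *\<^sub>R x) = of_real t ^ Suc d * partial_deriv h f x"
      using has_derivative_unique[OF d1[unfolded eq] d2] by meson
    then have "of_real t * partial_deriv h f (t *\<^sub>R x) = of_real t * (of_real t ^ d * partial_deriv h f x)"
      by (simp add: L.scaleR scaleR_conv_of_real mult.assoc)
    with that show ?thesis by simp
  qed
  have "partial_deriv h f (t *\<^sub>R x) = of_real t ^ d * partial_deriv h f x" for t x
  proof (cases "t = 0")
    case True
    have c: "continuous_on UNIV (partial_deriv h f)"
      by (intro complex_polynomial_continuous_on complex_polynomial_partial_deriv f)
    have c1: "continuous_on UNIV (\<lambda>t. partial_deriv h f (t *\<^sub>R x))"
      by (rule continuous_on_compose2[OF c]) (auto intro!: continuous_intros)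
    have 1: "((\<lambda>t. partial_deriv h f (t *\<^sub>R x)) \<longlongrightarrow> partial_deriv h f (0 *\<^sub>R x)) (at 0)"
      using c1 unfolding continuous_on_def by blast
    have 2: "((\<lambda>t. of_real t ^ d * partial_deriv h f x) \<longlongrightarrow> of_real 0 ^ d * partial_deriv h f x) (at (0::real))"
      by (intro tendsto_intros)
    have "((\<lambda>t. partial_deriv h f (t *\<^sub>R x)) \<longlongrightarrow> of_real 0 ^ d * partial_deriv h f x) (at 0)"
      by (rule Lim_transform_eventually[OF 2]) (auto simp: eventually_at_filter nz)
    then show ?thesis using tendsto_unique[OF _ 1] True by auto
  qed (rule nz)
  then show ?thesis unfolding homogeneous_def by blast
qed

lemma euler_identity:
  assumes f: "complex_polynomial f" "homogeneous d f"
  shows "(\<Sum>b\<in>Basis. of_real (x \<bullet> b) * partial_deriv b f x) = of_nat d * f x"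
proof -
  have "partial_deriv x f x = vector_derivative (\<lambda>t. of_real (1 + t) ^ d * f x) (at 0)"
    using f(2) unfolding partial_deriv_def homogeneous_def by (metis scaleR_add_left scaleR_one)
  also have "\<dots> = of_nat d * f x"
  proof (rule vector_derivative_at)
    have "((\<lambda>t. of_real ((1 + t) ^ d) * f x) has_vector_derivative of_real (real d * (1 + 0) ^ (d - 1)) * f x) (at 0)"
      by (rule has_vector_derivative_mult_left, rule has_vector_derivative_of_real)
         (auto intro!: derivative_eq_intros simp flip: has_real_derivative_iff_has_vector_derivative)
    then show "((\<lambda>t. of_real (1 + t) ^ d * f x) has_vector_derivative of_nat d * f x) (at 0)"
      by simp
  qed
  finally show ?thesis
    by (simp add: partial_deriv_basis_expansion[OF f(1), of x])
qed

section \<open>Integration by parts on the sphere and orthogonality of harmonic polynomials\<close>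

definition plane_rotation :: "'a::euclidean_space \<Rightarrow> 'a \<Rightarrow> real \<Rightarrow> 'a \<Rightarrow> 'a" where
  "plane_rotation j k \<theta> x = x + (cos \<theta> - 1) *\<^sub>R ((x \<bullet> j) *\<^sub>R j + (x \<bullet> k) *\<^sub>R k)
      + sin \<theta> *\<^sub>R ((x \<bullet> j) *\<^sub>R k - (x \<bullet> k) *\<^sub>R j)"

definition rotation_field :: "'a::euclidean_space \<Rightarrow> 'a \<Rightarrow> 'a \<Rightarrow> 'a" where
  "rotation_field j k x = (x \<bullet> j) *\<^sub>R k - (x \<bullet> k) *\<^sub>R j"

lemma linear_plane_rotation: "linear (plane_rotation j k \<theta>)"
  unfolding plane_rotation_def by (intro linearI) (simp_all add: inner_add_left algebra_simps)

lemma norm_plane_rotation: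
  assumes "j \<in> Basis" "k \<in> Basis" "j \<noteq> k"
  shows "norm (plane_rotation j k \<theta> x) = norm x"
proof -
  define a where "a = x \<bullet> j"
  define b where "b = x \<bullet> k"
  define \<alpha> where "\<alpha> = (cos \<theta> - 1) * a - sin \<theta> * b"
  define \<beta> where "\<beta> = (cos \<theta> - 1) * b + sin \<theta> * a"
  have jk: "j \<bullet> j = 1" "k \<bullet> k = 1" "j \<bullet> k = 0" "k \<bullet> j = 0"
    using assms by (auto simp: inner_Basis)
  have "plane_rotation j k \<theta> x = x + (\<alpha> *\<^sub>R j + \<beta> *\<^sub>R k)"
    by (simp add: plane_rotation_def a_def b_def \<alpha>_def \<beta>_def algebra_simps)
  then have "plane_rotation j k \<theta> x \<bullet> plane_rotation j k \<theta> x = x \<bullet> x + 2 * (\<alpha> * a + \<beta> * b) + (\<alpha>\<^sup>2 + \<beta>\<^sup>2)"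
    using jk inner_commute[of j x] inner_commute[of k x]
    by (simp add: inner_add_left inner_add_right a_def[symmetric] b_def[symmetric] power2_eq_square algebra_simps)
  also have "\<alpha>\<^sup>2 + \<beta>\<^sup>2 = - 2 * (\<alpha> * a + \<beta> * b)"
  proof -
    have "((c - 1) * a - e * b)\<^sup>2 + ((c - 1) * b + e * a)\<^sup>2
        = - 2 * (((c - 1) * a - e * b) * a + ((c - 1) * b + e * a) * b) + (e\<^sup>2 + c\<^sup>2 - 1) * (a\<^sup>2 + b\<^sup>2)"
      for c e :: real
      by (simp add: power2_eq_square algebra_simps)
    from this[of "cos \<theta>" "sin \<theta>"] show ?thesis by (simp add: \<alpha>_def \<beta>_def)
  qed
  finally have "plane_rotation j k \<theta> x \<bullet> plane_rotation j k \<theta> x = x \<bullet> x" by simp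
  then show ?thesis by (simp add: norm_eq_sqrt_inner)
qed

lemma plane_rotation_derivative:
  assumes "j \<in> Basis" "k \<in> Basis" "j \<noteq> k"
  shows "((\<lambda>\<theta>. plane_rotation j k \<theta> x) has_vector_derivative
    rotation_field j k (plane_rotation j k \<theta> x)) (at \<theta>)"
proof -
  have jk: "j \<bullet> j = 1" "k \<bullet> k = 1" "j \<bullet> k = 0" "k \<bullet> j = 0"
    using assms by (auto simp: inner_Basis)
  have "((\<lambda>\<theta>. plane_rotation j k \<theta> x) has_vector_derivative
     - sin \<theta> *\<^sub>R ((x \<bullet> j) *\<^sub>R j + (x \<bullet> k) *\<^sub>R k) + cos \<theta> *\<^sub>R ((x \<bullet> j) *\<^sub>R k - (x \<bullet> k) *\<^sub>R j)) (at \<theta>)"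
    unfolding plane_rotation_def
    by (auto intro!: derivative_eq_intros simp flip: has_real_derivative_iff_has_vector_derivative)
  also have "- sin \<theta> *\<^sub>R ((x \<bullet> j) *\<^sub>R j + (x \<bullet> k) *\<^sub>R k) + cos \<theta> *\<^sub>R ((x \<bullet> j) *\<^sub>R k - (x \<bullet> k) *\<^sub>R j)
     = rotation_field j k (plane_rotation j k \<theta> x)"
    by (simp add: rotation_field_def plane_rotation_def inner_add_left inner_diff_left jk algebra_simps)
  finally show ?thesis .
qed

text \<open>The mean of \<open>u\<close> over the sphere does not change if \<open>u\<close> is composed with a rotation by the angle
\<open>\<theta>\<close>; this is the derivative of that fact at \<open>\<theta> = 0\<close>. The difference quotients are bounded on the
sphere by the mean value theorem, so that the limit may be taken under the integral.\<close>

lemma integral_rotation_derivative_real: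
  fixes u :: "'a::euclidean_space \<Rightarrow> real"
  assumes u: "\<And>x. (u has_derivative u' x) (at x)"
    and c: "continuous_on UNIV (\<lambda>x. u' x (rotation_field j k x))"
    and jk: "j \<in> Basis" "k \<in> Basis" "j \<noteq> k"
  shows "(LINT w|unit_sphere_measure. u' w (rotation_field j k w)) = 0"
proof -
  interpret mu: finite_measure "unit_sphere_measure :: 'a measure"
    by (rule finite_measure_normalized_sphere_measure)
  define R where "R \<theta> x = plane_rotation j k \<theta> x" for \<theta> and x :: 'a
  define L where "L x = u' x (rotation_field j k x)" for x
  have uc: "continuous_on UNIV u"
    by (meson u continuous_at_imp_continuous_on has_derivative_continuous)
  have um[measurable]: "u \<in> borel_measurable borel" using uc by (rule borel_measurable_continuous_onI)
  have [measurable]: "R \<theta> \<in> borel_measurable borel" for \<theta>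
    unfolding R_def[abs_def] by (rule measurable_linear[OF linear_plane_rotation])
  have [measurable]: "L \<in> borel_measurable borel" 
    unfolding L_def[abs_def] using c by (rule borel_measurable_continuous_onI)
  have R0: "R 0 x = x" for x by (simp add: R_def plane_rotation_def)
  have nR: "norm (R \<theta> x) = norm x" for \<theta> x unfolding R_def by (rule norm_plane_rotation[OF jk])
  have D: "((\<lambda>\<theta>. u (R \<theta> x)) has_real_derivative L (R \<theta> x)) (at \<theta>)" for x \<theta>
  proof -
    interpret bounded_linear "u' (R \<theta> x)" using u by (rule has_derivative_bounded_linear)
    have "((\<lambda>\<theta>. R \<theta> x) has_derivative (\<lambda>h. h *\<^sub>R rotation_field j k (R \<theta> x))) (at \<theta>)"
      using plane_rotation_derivative[OF jk] unfolding R_def has_vector_derivative_def .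
    from has_derivative_compose[OF this u]
    show ?thesis by (simp add: has_field_derivative_def scaleR L_def mult.commute[of _ "u' _ _"])
  qed
  have "compact (L ` sphere 0 1)"
    using c unfolding L_def by (intro compact_continuous_image) (auto intro: continuous_on_subset)
  then have "bounded (L ` sphere 0 1)" by (rule compact_imp_bounded)
  then obtain B where B: "\<And>x. norm x = 1 \<Longrightarrow> \<bar>L x\<bar> \<le> B"
    unfolding bounded_iff by force
  define h where "h n = inverse (real (Suc n))" for n
  have h: "h n > 0" for n by (simp add: h_def)
  have hlim: "h \<longlonglongrightarrow> 0" unfolding h_def by (rule LIMSEQ_inverse_real_of_nat)
  define G where "G n w = (u (R (h n) w) - u w) / h n" for n w
  have zero: "(LINT w|unit_sphere_measure. G n w) = 0" for n
  proof -
    have "integrable unit_sphere_measure (\<lambda>w. u (R (h n) w))"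
      unfolding R_def
      by (intro integrable_unit_sphere_measure continuous_on_compose2[OF uc] linear_continuous_on)
         (simp_all add: linear_plane_rotation linear_linear)
    moreover have "integrable unit_sphere_measure u"
      by (rule integrable_unit_sphere_measure[OF uc])
    moreover have "(LINT w|unit_sphere_measure. u (R (h n) w)) = (LINT w|unit_sphere_measure. u w)"
      unfolding R_def
      by (rule integral_unit_sphere_measure_isometry[OF linear_plane_rotation norm_plane_rotation[OF jk] um])
    ultimately show ?thesis by (simp add: G_def)
  qed
  have "(\<lambda>n. LINT w|unit_sphere_measure. G n w) \<longlonglongrightarrow> (LINT w|unit_sphere_measure. L w)"
  proof (rule integral_dominated_convergence)
    show "integrable unit_sphere_measure (\<lambda>w::'a. B)" by simp
    show "AE w in unit_sphere_measure. (\<lambda>n. G n w) \<longlonglongrightarrow> L w"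
    proof (rule AE_I2)
      fix w
      have "(\<lambda>t. (u (R (0 + t) w) - u (R 0 w)) / t) \<midarrow>0\<rightarrow> L (R 0 w)"
        using D[of w 0] unfolding DERIV_def .
      then have "(\<lambda>t. (u (R t w) - u w) / t) \<midarrow>0\<rightarrow> L w" by (simp add: R0)
      moreover have "filterlim h (at 0) sequentially"
        using hlim h by (auto simp: filterlim_at intro!: always_eventually) (metis less_irrefl)
      ultimately show "(\<lambda>n. G n w) \<longlonglongrightarrow> L w"
        unfolding G_def by (rule filterlim_compose)
    qed
    show "AE w in unit_sphere_measure. norm (G n w) \<le> B" for n
      using AE_unit_sphere_measure
    proof eventually_elim
      fix w :: 'a assume w: "norm w = 1"
      obtain \<xi> where \<xi>: "u (R (h n) w) - u (R 0 w) = (h n - 0) * L (R \<xi> w)"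
        using MVT2[of 0 "h n" "\<lambda>\<theta>. u (R \<theta> w)" "\<lambda>\<theta>. L (R \<theta> w)"] D h by blast
      have "\<bar>L (R \<xi> w)\<bar> \<le> B" by (rule B) (simp add: nR w)
      then show "norm (G n w) \<le> B" using \<xi> h[of n] by (simp add: G_def R0 less_imp_neq[symmetric])
    qed
    show "G n \<in> borel_measurable unit_sphere_measure" for n unfolding G_def[abs_def] by simp
  qed simp
  then show ?thesis by (simp add: zero LIMSEQ_const_iff L_def[symmetric])
qed

lemma integral_rotation_derivative:
  fixes f :: "'a::euclidean_space \<Rightarrow> complex"
  assumes f: "complex_polynomial f" and jk: "j \<in> Basis" "k \<in> Basis"
  shows "(LINT w|unit_sphere_measure. of_real (w \<bullet> j) * partial_deriv k f w - of_real (w \<bullet> k) * partial_deriv j f w) = 0"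
proof (cases "j = k")
  case False
  define L where "L w = of_real (w \<bullet> j) * partial_deriv k f w - of_real (w \<bullet> k) * partial_deriv j f w" for w
  have Leq: "partial_deriv (rotation_field j k w) f w = L w" for w
  proof -
    interpret bounded_linear "\<lambda>h. partial_deriv h f w"
      using complex_polynomial_has_derivative[OF f] by (rule has_derivative_bounded_linear)
    show ?thesis by (simp add: L_def rotation_field_def diff scaleR scaleR_conv_of_real)
  qed
  have cL: "continuous_on UNIV L"
    unfolding L_def
    by (intro continuous_intros complex_polynomial_continuous_on complex_polynomial_partial_deriv f)
  have i: "integrable unit_sphere_measure L" by (rule integrable_unit_sphere_measure[OF cL])
  note d = complex_polynomial_has_derivative[OF f]
  have "(LINT w|unit_sphere_measure. Re (L w)) = 0"
    using integral_rotation_derivative_real[OF bounded_linear.has_derivative[OF bounded_linear_Re d] _ jk False]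
      cL by (simp add: Leq continuous_intros)
  moreover have "(LINT w|unit_sphere_measure. Im (L w)) = 0"
    using integral_rotation_derivative_real[OF bounded_linear.has_derivative[OF bounded_linear_Im d] _ jk False]
      cL by (simp add: Leq continuous_intros)
  ultimately have "(LINT w|unit_sphere_measure. L w) = 0"
    using integral_Re[OF i] integral_Im[OF i] by (simp add: complex_eq_iff)
  then show ?thesis by (simp add: L_def)
qed simp

lemma bounded_linear_coordinate: "bounded_linear (\<lambda>x. of_real (x \<bullet> b) :: complex)"
  by (rule bounded_linear_compose[OF bounded_linear_of_real bounded_linear_inner_left])

text \<open>Apply the vanishing of the means of \<open>(x\<^sub>j \<partial>\<^sub>k - x\<^sub>k \<partial>\<^sub>j) f\<^sub>j\<close> to \<open>f\<^sub>j = x\<^sub>j g\<close> and sum over \<open>j\<close>. On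
the unit sphere \<open>\<Sum>x\<^sub>j\<^sup>2 = 1\<close>, and Euler's identity evaluates \<open>\<Sum>x\<^sub>j \<partial>\<^sub>j g = e g\<close>, so the sum is
\<open>\<partial>\<^sub>k g - (N - 1 + e) x\<^sub>k g\<close>. This takes the place of the divergence theorem.\<close>

lemma sphere_integration_by_parts:
  fixes g :: "'a::euclidean_space \<Rightarrow> complex"
  assumes g: "complex_polynomial g" "homogeneous e g" and k: "k \<in> Basis"
  shows "(LINT w|unit_sphere_measure. partial_deriv k g w) =
    of_nat (DIM('a) - 1 + e) * (LINT w|unit_sphere_measure. of_real (w \<bullet> k) * g w)"
proof -
  define f where "f j x = of_real (x \<bullet> j) * g x" for j and x :: 'a
  have pl: "complex_polynomial (\<lambda>x::'a. of_real (x \<bullet> j))" for j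
    by (intro complex_polynomial_linear bounded_linear_coordinate)
  have f: "complex_polynomial (f j)" for j
    unfolding f_def by (intro complex_polynomial_mult pl g)
  have df: "partial_deriv h (f j) x = of_real (x \<bullet> j) * partial_deriv h g x + of_real (h \<bullet> j) * g x" for h j x
    unfolding f_def by (subst partial_deriv_mult[OF pl g(1)])
      (simp add: partial_deriv_linear[OF bounded_linear_coordinate])
  define L where "L j w = of_real (w \<bullet> j) * partial_deriv k (f j) w - of_real (w \<bullet> k) * partial_deriv j (f j) w" for j and w :: 'a
  have Li: "integrable unit_sphere_measure (L j)" for j
    unfolding L_def
    by (intro integrable_unit_sphere_measure continuous_intros complex_polynomial_continuous_on complex_polynomial_partial_deriv f)
  have i1: "integrable unit_sphere_measure (partial_deriv k g)"
    by (intro complex_polynomial_integrable complex_polynomial_partial_deriv g)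
  have i2: "integrable unit_sphere_measure (\<lambda>w. of_real (w \<bullet> k) * g w)"
    by (intro complex_polynomial_integrable complex_polynomial_mult pl g)
  have pt: "(\<Sum>j\<in>Basis. L j w) = partial_deriv k g w - of_nat (DIM('a) - 1 + e) * (of_real (w \<bullet> k) * g w)"
    if w: "norm w = 1" for w :: 'a
  proof -
    have sq: "(\<Sum>j\<in>Basis. (complex_of_real (w \<bullet> j))\<^sup>2) = 1"
    proof -
      have "(\<Sum>j\<in>Basis. (w \<bullet> j) * (w \<bullet> j)) = 1"
        using w by (simp add: norm_eq_1 flip: euclidean_inner)
      then have "of_real (\<Sum>j\<in>Basis. (w \<bullet> j)\<^sup>2) = (1::complex)" by (simp add: power2_eq_square)
      then show ?thesis by simp
    qed
    have kk: "(\<Sum>j\<in>Basis. complex_of_real (w \<bullet> j) * of_real (k \<bullet> j)) = of_real (w \<bullet> k)"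
    proof -
      have "of_real (\<Sum>j\<in>Basis. (w \<bullet> j) * (k \<bullet> j)) = complex_of_real (w \<bullet> k)"
        by (simp add: euclidean_inner[of w k])
      then show ?thesis by simp
    qed
    have "L j w = (of_real (w \<bullet> j))\<^sup>2 * partial_deriv k g w + of_real (w \<bullet> j) * of_real (k \<bullet> j) * g w
        - of_real (w \<bullet> k) * (of_real (w \<bullet> j) * partial_deriv j g w) - of_real (w \<bullet> k) * g w" if "j \<in> Basis" for j
      using that by (simp add: L_def df power2_eq_square algebra_simps)
    then have "(\<Sum>j\<in>Basis. L j w) = (\<Sum>j\<in>Basis. (of_real (w \<bullet> j))\<^sup>2 * partial_deriv k g w + of_real (w \<bullet> j) * of_real (k \<bullet> j) * g w
        - of_real (w \<bullet> k) * (of_real (w \<bullet> j) * partial_deriv j g w) - of_real (w \<bullet> k) * g w)"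
      by (rule sum.cong[OF refl])
    also have "\<dots> = (\<Sum>j\<in>Basis. (of_real (w \<bullet> j))\<^sup>2) * partial_deriv k g w
        + (\<Sum>j\<in>Basis. of_real (w \<bullet> j) * of_real (k \<bullet> j)) * g w
        - of_real (w \<bullet> k) * (\<Sum>j\<in>Basis. of_real (w \<bullet> j) * partial_deriv j g w)
        - of_nat DIM('a) * (of_real (w \<bullet> k) * g w)"
      by (simp add: sum.distrib sum_subtractf sum_distrib_left sum_distrib_right)
    also have "\<dots> = partial_deriv k g w + of_real (w \<bullet> k) * g w - of_real (w \<bullet> k) * (of_nat e * g w)
        - of_nat DIM('a) * (of_real (w \<bullet> k) * g w)"
      by (simp add: sq kk euler_identity[OF g])
    also have "\<dots> = partial_deriv k g w - of_nat (DIM('a) - 1 + e) * (of_real (w \<bullet> k) * g w)"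
      by (simp add: of_nat_diff Suc_leI algebra_simps)
    finally show ?thesis .
  qed
  have "0 = (\<Sum>j\<in>Basis. LINT w|unit_sphere_measure. L j w)"
    unfolding L_def using k by (simp add: integral_rotation_derivative[OF f])
  also have "\<dots> = (LINT w|unit_sphere_measure. (\<Sum>j\<in>Basis. L j w))"
    using Li by (simp add: Bochner_Integration.integral_sum)
  also have "\<dots> = (LINT w|unit_sphere_measure. partial_deriv k g w - of_nat (DIM('a) - 1 + e) * (of_real (w \<bullet> k) * g w))"
  proof (rule integral_cong_AE)
    show "AE w in unit_sphere_measure. (\<Sum>j\<in>Basis. L j w) = partial_deriv k g w - of_nat (DIM('a) - 1 + e) * (of_real (w \<bullet> k) * g w)"
      using AE_unit_sphere_measure by eventually_elim (rule pt)
  qed (use Li i1 i2 in \<open>auto intro!: borel_measurable_sum borel_measurable_integrable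
        Bochner_Integration.integrable_diff Bochner_Integration.integrable_sum\<close>)
  also have "\<dots> = (LINT w|unit_sphere_measure. partial_deriv k g w) - of_nat (DIM('a) - 1 + e) * (LINT w|unit_sphere_measure. of_real (w \<bullet> k) * g w)"
    using i1 i2 by (subst Bochner_Integration.integral_diff) auto
  finally show ?thesis by simp
qed

lemma laplacian_partial_deriv:
  assumes "complex_polynomial P"
  shows "laplacian (partial_deriv k P) x = partial_deriv k (laplacian P) x"
proof -
  have 1: "complex_polynomial (partial_deriv b (partial_deriv b P))" for b
    by (intro complex_polynomial_partial_deriv assms)
  have "laplacian P = (\<lambda>x. \<Sum>b\<in>Basis. partial_deriv b (partial_deriv b P) x)"
    by (simp add: laplacian_def fun_eq_iff)
  then have "partial_deriv k (laplacian P) = (\<lambda>x. \<Sum>b\<in>Basis. partial_deriv k (partial_deriv b (partial_deriv b P)) x)"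
    by (simp add: partial_deriv_sum 1)
  moreover have "partial_deriv k (partial_deriv b (partial_deriv b P)) = partial_deriv b (partial_deriv b (partial_deriv k P))" for b
    by (metis assms complex_polynomial_partial_deriv partial_deriv_commute)
  ultimately show ?thesis by (simp add: laplacian_def)
qed

text \<open>By Euler's identity \<open>l P Q = \<Sum>x\<^sub>b P \<partial>\<^sub>b Q\<close>, and integration by parts turns each term into a
multiple of the mean of \<open>\<partial>\<^sub>b P \<partial>\<^sub>b Q + P \<partial>\<^sub>b\<^sup>2 Q\<close>. In the first product both degrees drop by one
and the first factor is still harmonic, in the second the degree of \<open>Q\<close> drops by two; so induction
on \<open>l\<close> applies. For \<open>l = 0\<close> the same computation for \<open>P\<close> itself leads to the mean of the
Laplacian, which is 0.\<close>

theorem harmonic_orthogonal_lower_degree: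
  fixes P Q :: "'a::euclidean_space \<Rightarrow> complex"
  assumes "complex_polynomial P" "homogeneous d P" "\<And>x. laplacian P x = 0"
    and "complex_polynomial Q" "homogeneous l Q" and "l < d" and "DIM('a) \<ge> 2"
  shows "(LINT w|unit_sphere_measure. P w * Q w) = 0"
  using assms(1-6)
proof (induction l arbitrary: d P Q rule: less_induct)
  case (less l)
  note P = less.prems(1-3) and Q = less.prems(4,5)
  obtain d' where d': "d = Suc d'" using less.prems(6) by (cases d) auto
  have pl: "complex_polynomial (\<lambda>x::'a. of_real (x \<bullet> j))" for j
    by (intro complex_polynomial_linear bounded_linear_coordinate)
  have P1: "complex_polynomial (partial_deriv k P)" "homogeneous d' (partial_deriv k P)"
    "laplacian (partial_deriv k P) x = 0" for k x
  proof -
    have "laplacian P = (\<lambda>x. 0)" using P(3) by blast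
    then show "laplacian (partial_deriv k P) x = 0"
      by (simp add: laplacian_partial_deriv[OF P(1)] partial_deriv_const)
  qed (use P d' in \<open>auto intro: complex_polynomial_partial_deriv homogeneous_partial_deriv\<close>)
  show ?case
  proof (cases l)
    case 0
    have Qc: "Q w = Q 0" for w
      using homogeneous_0_eq_const[of Q] Q(2) 0 by metis
    have i: "integrable unit_sphere_measure (\<lambda>w. of_real (w \<bullet> b) * partial_deriv b P w)" for b
      by (intro complex_polynomial_integrable complex_polynomial_mult pl P1)
    have i2: "integrable unit_sphere_measure (partial_deriv b (partial_deriv b P))" for b
      by (intro complex_polynomial_integrable complex_polynomial_partial_deriv P)
    have nz: "of_nat (DIM('a) - 1 + d') \<noteq> (0::complex)" using assms(7) by (simp del: of_nat_add)
    have "of_nat (DIM('a) - 1 + d') * (of_nat d * (LINT w|unit_sphere_measure. P w))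
       = of_nat (DIM('a) - 1 + d') * (LINT w|unit_sphere_measure. (\<Sum>b\<in>Basis. of_real (w \<bullet> b) * partial_deriv b P w))"
      by (simp add: euler_identity[OF P(1,2)])
    also have "\<dots> = (\<Sum>b\<in>Basis. of_nat (DIM('a) - 1 + d') * (LINT w|unit_sphere_measure. of_real (w \<bullet> b) * partial_deriv b P w))"
      using i by (simp add: Bochner_Integration.integral_sum sum_distrib_left)
    also have "\<dots> = (\<Sum>b\<in>Basis. LINT w|unit_sphere_measure. partial_deriv b (partial_deriv b P) w)"
      by (intro sum.cong refl sphere_integration_by_parts[symmetric] P1)
    also have "\<dots> = (LINT w|unit_sphere_measure. laplacian P w)"
      unfolding laplacian_def using i2 by (simp add: Bochner_Integration.integral_sum)
    also have "\<dots> = 0" by (simp add: P(3))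
    finally have "(LINT w|unit_sphere_measure. P w) = 0" using nz d' by (simp del: of_nat_Suc of_nat_add)
    moreover have "(\<lambda>w. P w * Q w) = (\<lambda>w. P w * Q 0)" by (rule ext) (metis Qc)
    ultimately show ?thesis by simp
  next
    case (Suc l')
    have Q1: "complex_polynomial (partial_deriv k Q)" "homogeneous l' (partial_deriv k Q)" for k
      using Q Suc by (auto intro: complex_polynomial_partial_deriv homogeneous_partial_deriv)
    have nz: "of_nat (DIM('a) - 1 + (d + l')) \<noteq> (0::complex)" using assms(7) by (simp del: of_nat_add)
    have ih1: "(LINT w|unit_sphere_measure. partial_deriv b P w * partial_deriv b Q w) = 0" for b
      using less.IH[of l' "partial_deriv b P" d' "partial_deriv b Q"] P1 Q1 Suc less.prems(6) d' by auto
    have ih2: "(LINT w|unit_sphere_measure. P w * partial_deriv b (partial_deriv b Q) w) = 0" for b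
    proof (cases l')
      case 0
      then have "partial_deriv b Q = (\<lambda>x. partial_deriv b Q 0)"
        using Q1(2)[of b] by (intro homogeneous_0_eq_const) simp
      then have "partial_deriv b (partial_deriv b Q) = (\<lambda>x. 0)"
        by (metis partial_deriv_const)
      then show ?thesis by simp
    next
      case (Suc l'')
      have "homogeneous l'' (partial_deriv b (partial_deriv b Q))"
        using homogeneous_partial_deriv[OF Q1(1)] Q1(2) Suc by metis
      then show ?thesis
        using less.IH[of l'' P d "partial_deriv b (partial_deriv b Q)"] P Q1 Suc \<open>l = Suc l'\<close> less.prems(6)
        by (auto intro: complex_polynomial_partial_deriv)
    qed
    have i: "integrable unit_sphere_measure (\<lambda>w. of_real (w \<bullet> b) * (P w * partial_deriv b Q w))" for b
      by (intro complex_polynomial_integrable complex_polynomial_mult pl P Q1)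
    have i1: "integrable unit_sphere_measure (\<lambda>w. partial_deriv b P w * partial_deriv b Q w)"
     and i2: "integrable unit_sphere_measure (\<lambda>w. P w * partial_deriv b (partial_deriv b Q) w)" for b
      by (intro complex_polynomial_integrable complex_polynomial_mult complex_polynomial_partial_deriv P Q)+
    have term0: "(LINT w|unit_sphere_measure. of_real (w \<bullet> b) * (P w * partial_deriv b Q w)) = 0" if b: "b \<in> Basis" for b
    proof -
      have "of_nat (DIM('a) - 1 + (d + l')) * (LINT w|unit_sphere_measure. of_real (w \<bullet> b) * (P w * partial_deriv b Q w))
        = (LINT w|unit_sphere_measure. partial_deriv b (\<lambda>w. P w * partial_deriv b Q w) w)"
        by (intro sphere_integration_by_parts[symmetric] complex_polynomial_mult homogeneous_mult P Q1 b)
      also have "\<dots> = (LINT w|unit_sphere_measure. P w * partial_deriv b (partial_deriv b Q) w + partial_deriv b P w * partial_deriv b Q w)"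
        by (subst partial_deriv_mult[OF P(1) Q1(1)]) simp
      also have "\<dots> = 0" using i1 i2 ih1 ih2 by simp
      finally show ?thesis using nz by simp
    qed
    have "of_nat l * (LINT w|unit_sphere_measure. P w * Q w) = (LINT w|unit_sphere_measure. P w * (of_nat l * Q w))"
      by (simp add: mult.left_commute[of _ "of_nat l"])
    also have "\<dots> = (LINT w|unit_sphere_measure. (\<Sum>b\<in>Basis. of_real (w \<bullet> b) * (P w * partial_deriv b Q w)))"
      unfolding euler_identity[OF Q, symmetric] by (simp add: sum_distrib_left mult.left_commute)
    also have "\<dots> = 0" using i term0 by (simp add: Bochner_Integration.integral_sum)
    finally show ?thesis using Suc by (simp del: of_nat_Suc)
  qed
qed

section \<open>Powers of the ray length\<close>

text \<open>The numbers \<open>S\<^sub>M = ((x + D)\<^sup>M - (x - D)\<^sup>M) / D\<close> form a Lucas sequence: \<open>x \<plusminus> D\<close> are the roots of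
\<open>X\<^sup>2 = 2 x X + \<kappa>\<close> with the constant \<open>\<kappa> = s\<^sup>2 - |z|\<^sup>2\<close>, hence \<open>S\<^sub>0 = 0\<close>, \<open>S\<^sub>1 = 2\<close> and
\<open>S\<^sub>M\<^sub>+\<^sub>2 = 2 x S\<^sub>M\<^sub>+\<^sub>1 + \<kappa> S\<^sub>M\<close>. So \<open>S\<^sub>M\<close> is a polynomial in \<open>x\<close> of degree less than \<open>M\<close>, although
\<open>D\<close> is not. The additional power \<open>x\<^sup>e\<close> makes the induction along the recursion work.\<close>

lemma integral_sphere_lucas:
  fixes A :: "'a::euclidean_space \<Rightarrow> complex"
  assumes A: "continuous_on UNIV A" and z: "norm z < s"
    and van: "\<And>l. l < B \<Longrightarrow> (LINT w|unit_sphere_measure. A w * of_real (z \<bullet> w) ^ l) = 0"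
    and "e + M \<le> B"
  shows "(LINT w|unit_sphere_measure. A w * of_real ((z \<bullet> w) ^ e *
      (((z \<bullet> w + ray_disc z s w) ^ M - (z \<bullet> w - ray_disc z s w) ^ M) / ray_disc z s w))) = 0"
  using assms(4)
proof (induction M arbitrary: e rule: induct_nat_012)
  case 0
  then show ?case by simp
next
  case 1
  have "(((z \<bullet> w + ray_disc z s w) ^ 1 - (z \<bullet> w - ray_disc z s w) ^ 1) / ray_disc z s w) = 2" for w
    using ray_disc_pos[OF z, of w] by (simp add: field_simps)
  then have "(LINT w|unit_sphere_measure. A w * of_real ((z \<bullet> w) ^ e *
      (((z \<bullet> w + ray_disc z s w) ^ 1 - (z \<bullet> w - ray_disc z s w) ^ 1) / ray_disc z s w)))
    = (LINT w|unit_sphere_measure. (A w * of_real (z \<bullet> w) ^ e) * 2)"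
    by (simp only: of_real_mult of_real_power of_real_numeral mult.assoc)
  also have "\<dots> = 0" using van[of e] 1 by simp
  finally show ?case by simp
next
  case (ge2 M)
  define \<kappa> where "\<kappa> = s\<^sup>2 - (norm z)\<^sup>2"
  define S where "S M w = ((z \<bullet> w + ray_disc z s w) ^ M - (z \<bullet> w - ray_disc z s w) ^ M) / ray_disc z s w" for M w
  have rec: "S (Suc (Suc M)) w = 2 * (z \<bullet> w) * S (Suc M) w + \<kappa> * S M w" for M w
  proof -
    have D: "(ray_disc z s w)\<^sup>2 = (z \<bullet> w)\<^sup>2 + \<kappa>" unfolding \<kappa>_def by (rule ray_disc_sq[OF z])
    have r1: "(z \<bullet> w + ray_disc z s w)\<^sup>2 = 2 * (z \<bullet> w) * (z \<bullet> w + ray_disc z s w) + \<kappa>"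
     and r2: "(z \<bullet> w - ray_disc z s w)\<^sup>2 = 2 * (z \<bullet> w) * (z \<bullet> w - ray_disc z s w) + \<kappa>"
      using D by (simp_all add: power2_eq_square algebra_simps)
    have step: "X ^ Suc (Suc M) = 2 * (z \<bullet> w) * X ^ Suc M + \<kappa> * X ^ M"
      if "X\<^sup>2 = 2 * (z \<bullet> w) * X + \<kappa>" for X
    proof -
      have "X ^ Suc (Suc M) = X ^ M * X\<^sup>2" by (simp add: power2_eq_square)
      then show ?thesis unfolding that by (simp add: algebra_simps)
    qed
    show ?thesis
      unfolding S_def step[OF r1] step[OF r2]
      by (simp add: diff_divide_distrib add_divide_distrib algebra_simps)
  qed
  have cS: "continuous_on UNIV (S M)" for M
    unfolding S_def using ray_disc_pos[OF z] by (intro continuous_intros) (metis less_irrefl)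
  have i: "integrable unit_sphere_measure (\<lambda>w. A w * of_real ((z \<bullet> w) ^ e * S M w))" for e M
    by (intro integrable_unit_sphere_measure continuous_intros A cS)
  have "(LINT w|unit_sphere_measure. A w * of_real ((z \<bullet> w) ^ e * S (Suc (Suc M)) w))
     = (LINT w|unit_sphere_measure. 2 * (A w * of_real ((z \<bullet> w) ^ Suc e * S (Suc M) w))
          + of_real \<kappa> * (A w * of_real ((z \<bullet> w) ^ e * S M w)))"
    by (intro Bochner_Integration.integral_cong refl) (simp add: rec algebra_simps)
  also have "\<dots> = 0"
  proof -
    have "(LINT w|unit_sphere_measure. A w * of_real ((z \<bullet> w) ^ e * S M w)) = 0"
      unfolding S_def by (rule ge2.IH(1)) (use ge2.prems in simp)
    moreover have "(LINT w|unit_sphere_measure. A w * of_real ((z \<bullet> w) ^ Suc e * S (Suc M) w)) = 0"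
      unfolding S_def by (rule ge2.IH(2)) (use ge2.prems in simp)
    ultimately show ?thesis using i[of e M] i[of "Suc e" "Suc M"]
      by (simp del: of_real_mult of_real_power power_Suc)
  qed
  finally show ?case by (simp only: S_def)
qed

text \<open>The mean is unchanged under \<open>w \<mapsto> - w\<close>, which turns \<open>\<rho> = x + D\<close> into \<open>- (x - D)\<close>. For the given
parity, averaging over both directions replaces \<open>\<rho>\<^sup>m / D\<close> by half of
\<open>((x + D)\<^sup>m - (x - D)\<^sup>m) / D\<close>. This is a polynomial in \<open>x\<close> of degree less than \<open>|m|\<close>, also for negative
\<open>m\<close>, since \<open>(x + D) (x - D)\<close> is the constant \<open>- \<kappa>\<close>.\<close>

lemma integral_sphere_ray_power:
  fixes A :: "'a::euclidean_space \<Rightarrow> complex"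
  assumes A: "continuous_on UNIV A" "\<And>w. A (- w) = (- 1) ^ a * A w" and z: "norm z < s"
    and par: "even (m + 1 + int a)"
    and van: "\<And>l. int l < \<bar>m\<bar> \<Longrightarrow> (LINT w|unit_sphere_measure. A w * of_real (z \<bullet> w) ^ l) = 0"
  shows "(LINT w|unit_sphere_measure. A w * of_real (ray_length z s w powi m / ray_disc z s w)) = 0"
proof -
  define \<kappa> where "\<kappa> = s\<^sup>2 - (norm z)\<^sup>2"
  define M where "M = nat \<bar>m\<bar>"
  define D where "D w = ray_disc z s w" for w
  define X where "X w = z \<bullet> w + D w" for w
  define Y where "Y w = z \<bullet> w - D w" for w
  have Dpos: "D w > 0" for w unfolding D_def by (rule ray_disc_pos[OF z])
  have X: "X w > 0" for w using ray_length_pos[OF z, of w] by (simp add: X_def D_def ray_length_def)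
  have Y: "Y w < 0" for w using ray_disc_gt[OF z, of w] by (simp add: Y_def D_def)
  have XY: "X w * Y w = - \<kappa>" for w
    using ray_disc_sq[OF z, of w] by (simp add: X_def Y_def D_def \<kappa>_def power2_eq_square algebra_simps)
  have \<kappa>: "\<kappa> > 0" using XY[of 0] X[of 0] Y[of 0] by (metis mult_pos_neg neg_less_0_iff_less)
  have Dm: "D (- w) = D w" for w by (simp add: D_def ray_disc_def)
  have XmY: "X (- w) = - Y w" for w by (simp add: X_def Y_def Dm)
  have cD: "continuous_on UNIV D" unfolding D_def by (intro continuous_intros)
  have cX: "continuous_on UNIV X" "continuous_on UNIV Y" unfolding X_def Y_def by (intro continuous_intros cD)+
  have D0: "D w \<noteq> 0" and X0: "X w \<noteq> 0" and Y0: "Y w \<noteq> 0" for w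
    using Dpos[of w] X[of w] Y[of w] by auto
  have cpow: "continuous_on UNIV (\<lambda>w. g w powi m)" if "continuous_on UNIV g" "\<And>w. g w \<noteq> 0" for g :: "'a \<Rightarrow> real"
    using that by (cases "m \<ge> 0") (auto simp: power_int_def intro!: continuous_intros)
  define F where "F w = A w * of_real (X w powi m / D w)" for w
  define G where "G w = A w * of_real (Y w powi m / D w)" for w
  have iF: "integrable unit_sphere_measure F"
    unfolding F_def using D0 X0 by (intro integrable_unit_sphere_measure continuous_intros A cD cX cpow) auto
  have iG: "integrable unit_sphere_measure G"
    unfolding G_def using D0 Y0 by (intro integrable_unit_sphere_measure continuous_intros A cD cX cpow) auto
  have refl: "F (- w) = - G w" for w
  proof -
    have sgn: "(- 1) ^ a * (- 1) powi m = (- 1 :: real)"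
    proof -
      have "even (m + 1 + int a) \<Longrightarrow> (- 1) ^ a * (- 1) powi m = (- 1 :: real)"
        by (cases "even m") (auto simp: power_int_minus_one_minus)
      then show ?thesis using par .
    qed
    have "X (- w) powi m = (- 1) powi m * Y w powi m"
      unfolding XmY by (metis mult_minus1 power_int_mult_distrib)
    then have "F (- w) = A w * of_real (((- 1) ^ a * (- 1) powi m) * (Y w powi m / D w))"
      by (simp add: F_def A(2) Dm)
    then show ?thesis unfolding sgn by (simp add: G_def)
  qed
  have "(LINT w|unit_sphere_measure. F w) = (LINT w|unit_sphere_measure. F (- w))"
    by (rule integral_unit_sphere_measure_isometry[symmetric])
       (use iF in \<open>auto simp: linear_iff dest: borel_measurable_integrable\<close>)
  also have "\<dots> = - (LINT w|unit_sphere_measure. G w)" by (simp add: refl)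
  finally have "2 * (LINT w|unit_sphere_measure. F w) = (LINT w|unit_sphere_measure. F w - G w)"
    using iF iG by simp
  also have "\<dots> = 0"
  proof -
    \<comment> \<open>for negative exponents, inversion exchanges the two roots up to the factor \<open>- 1 / \<kappa>\<close>\<close>
    define c where "c = (if m \<ge> 0 then 1 else - ((- 1 / \<kappa>) ^ M))"
    have FG: "F w - G w = of_real c * (A w * of_real ((z \<bullet> w) ^ 0 * ((X w ^ M - Y w ^ M) / D w)))" for w
    proof (cases "m \<ge> 0")
      case True
      then have "X w powi m = X w ^ M" "Y w powi m = Y w ^ M" by (simp_all add: power_int_def M_def)
      with True show ?thesis by (simp add: F_def G_def c_def diff_divide_distrib algebra_simps)
    next
      case False
      have "inverse (X w) = (- 1 / \<kappa>) * Y w" "inverse (Y w) = (- 1 / \<kappa>) * X w"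
        using XY[of w] \<kappa> X0[of w] Y0[of w] by (auto simp: field_simps)
      then have "X w powi m = (- 1 / \<kappa>) ^ M * Y w ^ M" "Y w powi m = (- 1 / \<kappa>) ^ M * X w ^ M"
        using False by (simp_all only: power_int_def M_def if_False abs_if power_mult_distrib[symmetric]) auto
      with False show ?thesis by (simp add: F_def G_def c_def diff_divide_distrib algebra_simps)
    qed
    have "(LINT w|unit_sphere_measure. A w * of_real ((z \<bullet> w) ^ 0 * ((X w ^ M - Y w ^ M) / D w))) = 0"
      unfolding X_def Y_def D_def
      by (rule integral_sphere_lucas[OF A(1) z, where B = M]) (use van in \<open>auto simp: M_def\<close>)
    then show ?thesis unfolding FG by (simp only: integral_mult_right_zero mult_zero_right)
  qed
  finally show ?thesis by (simp add: F_def X_def D_def ray_length_def)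
qed

section \<open>Bigraded harmonic polynomials on complex space\<close>

lemma inner_eq_Re_cdot: "z \<bullet> w = Re (cdot (vcnj z) w)"
  by (simp add: inner_vec_def cdot_def vcnj_def inner_complex_def)

lemma of_real_inner_eq_cdot: "of_real (z \<bullet> w) = (cdot (vcnj z) w + cdot z (vcnj w)) / 2"
proof -
  have "cnj (cdot (vcnj z) w) = cdot z (vcnj w)"
    by (simp add: cdot_def vcnj_def)
  then show ?thesis
    by (metis complex_add_cnj inner_eq_Re_cdot nonzero_mult_div_cancel_left of_real_mult of_real_numeral zero_neq_numeral)
qed

lemma vcnj_scale: "vcnj (u *s z) = cnj u *s vcnj z"
  by (simp add: vcnj_def vec_eq_iff)

lemma scaleR_eq_vector_scale: "(t *\<^sub>R z :: complex^'n) = of_real t *s z"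
  by (simp add: vec_eq_iff) (simp add: scaleR_conv_of_real)

lemma cdot_scale [simp]: "cdot b (u *s z) = u * cdot b z"
  by (simp add: cdot_def sum_distrib_left algebra_simps)

lemma cdot_scale_left [simp]: "cdot (u *s b) z = u * cdot b z"
  by (simp add: cdot_def sum_distrib_left algebra_simps)

lemma cdot_scaleR: "cdot b (t *\<^sub>R z) = of_real t * cdot b z"
  by (simp add: scaleR_eq_vector_scale)

lemma cdot_add: "cdot b (x + y) = cdot b x + cdot b y"
  by (simp add: cdot_def sum.distrib algebra_simps)

lemma cdot_diff: "cdot b (x - y) = cdot b x - cdot b y"
  by (simp add: cdot_def sum_subtractf algebra_simps)

lemma bounded_linear_cdot: "bounded_linear (cdot b)"
  unfolding linear_conv_bounded_linear[symmetric]
  by (intro linearI) (simp_all add: cdot_add scaleR_eq_vector_scale scaleR_conv_of_real)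

lemma bounded_linear_cdot_vcnj: "bounded_linear (\<lambda>w. cdot b (vcnj w))"
  unfolding linear_conv_bounded_linear[symmetric]
proof (intro linearI)
  show "cdot b (vcnj (x + y)) = cdot b (vcnj x) + cdot b (vcnj y)" for x y
    by (simp add: cdot_def vcnj_def sum.distrib algebra_simps)
  show "cdot b (vcnj (r *\<^sub>R x)) = r *\<^sub>R cdot b (vcnj x)" for r x
    by (simp add: scaleR_eq_vector_scale vcnj_scale scaleR_conv_of_real)
qed

lemma multi_power_scale:
  "\<alpha> \<in> multi_indices p \<Longrightarrow> multi_power (u *s z) \<alpha> = u ^ p * multi_power z \<alpha>"
  by (auto simp: multi_power_def multi_indices_def power_mult_distrib prod.distrib power_sum)

lemma H_space_complex_polynomial:
  assumes "P \<in> H_space p q"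
  shows "complex_polynomial P"
proof -
  obtain c where P: "P = (\<lambda>z. \<Sum>\<alpha>\<in>multi_indices p. \<Sum>\<beta>\<in>multi_indices q.
      c \<alpha> \<beta> * multi_power z \<alpha> * multi_power (vcnj z) \<beta>)"
    using assms unfolding H_space_def by blast
  have 1: "complex_polynomial (\<lambda>z::complex^'a. multi_power z \<alpha>)" for \<alpha> :: "'a \<Rightarrow> nat"
    unfolding multi_power_def
    by (intro complex_polynomial_prod complex_polynomial_power complex_polynomial_linear bounded_linear_vec_nth)
  have 2: "complex_polynomial (\<lambda>z::complex^'a. multi_power (vcnj z) \<alpha>)" for \<alpha> :: "'a \<Rightarrow> nat"
    unfolding multi_power_def vcnj_def vec_lambda_beta
    by (intro complex_polynomial_prod complex_polynomial_power complex_polynomial_linear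
        bounded_linear_compose[OF bounded_linear_cnj bounded_linear_vec_nth])
  show ?thesis unfolding P
    by (intro complex_polynomial_sum complex_polynomial_mult complex_polynomial_const 1 2)
qed

lemma H_space_scale:
  assumes "P \<in> H_space p q"
  shows "P (u *s z) = u ^ p * cnj u ^ q * P z"
proof -
  obtain c where P: "P = (\<lambda>z. \<Sum>\<alpha>\<in>multi_indices p. \<Sum>\<beta>\<in>multi_indices q.
      c \<alpha> \<beta> * multi_power z \<alpha> * multi_power (vcnj z) \<beta>)"
    using assms unfolding H_space_def by blast
  show ?thesis
    unfolding P sum_distrib_left
    by (intro sum.cong refl) (simp add: vcnj_scale multi_power_scale)
qed

lemma H_space_homogeneous: "P \<in> H_space p q \<Longrightarrow> homogeneous (p + q) P"
  by (simp add: homogeneous_def scaleR_eq_vector_scale H_space_scale power_add)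

lemma H_space_harmonic: "P \<in> H_space p q \<Longrightarrow> laplacian P z = 0"
  by (simp add: H_space_def)

lemma linear_complex_scale: "linear (\<lambda>z::complex^'n. u *s z)"
  by (intro linearI) (simp_all add: vec_eq_iff algebra_simps scaleR_conv_of_real)

lemma norm_complex_scale: "norm (u *s z :: complex^'n) = cmod u * norm z"
proof -
  have "norm (u *s z) = norm (\<chi> i. cmod u *\<^sub>R norm (z $ i))"
    by (simp add: norm_vec_def norm_mult)
  also have "\<dots> = norm (cmod u *\<^sub>R (\<chi> i. norm (z $ i)))"
    by (intro arg_cong[of _ _ norm]) (simp add: vec_eq_iff)
  also have "\<dots> = cmod u * norm z"
    by (subst norm_scaleR) (simp add: norm_vec_def)
  finally show ?thesis .
qed

text \<open>Multiplication by a unit complex number \<open>u\<close> with \<open>u\<^sup>a\<^sup>-\<^sup>b = - 1\<close> preserves the mean and changes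
the sign of \<open>f\<close>.\<close>

lemma integral_sphere_positive_frequency:
  fixes f :: "complex^'n::finite \<Rightarrow> complex"
  assumes f: "f \<in> borel_measurable borel"
    and freq: "\<And>u w. f (u *s w) = u ^ a * cnj u ^ b * f w" and "b < a"
  shows "(LINT w|unit_sphere_measure. f w) = 0"
proof -
  define u where "u = cis (pi / real (a - b))"
  have "u ^ a = u ^ b * u ^ (a - b)" using \<open>b < a\<close> by (simp flip: power_add)
  then have "u ^ a * cnj u ^ b = (u * cnj u) ^ b * u ^ (a - b)"
    by (simp add: power_mult_distrib)
  also have "u * cnj u = 1" by (simp add: u_def cis_mult cis_cnj)
  also have "u ^ (a - b) = - 1"
  proof -
    have "u ^ (a - b) = cis (real (a - b) * (pi / real (a - b)))" unfolding u_def by (rule Complex.DeMoivre)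
    also have "real (a - b) * (pi / real (a - b)) = pi" using \<open>b < a\<close> by simp
    finally show ?thesis by simp
  qed
  finally have "u ^ a * cnj u ^ b = - 1" by simp
  then have "f (u *s w) = - f w" for w by (simp add: freq)
  moreover have "(LINT w|unit_sphere_measure. f (u *s w)) = (LINT w|unit_sphere_measure. f w)"
    by (rule integral_unit_sphere_measure_isometry[OF linear_complex_scale _ f])
       (simp add: norm_complex_scale u_def)
  ultimately show ?thesis by simp
qed

text \<open>Let \<open>m = 2 i - p - q - 1 + k\<close>, so that \<open>l < |m|\<close>. If \<open>m < 0\<close>, then \<open>k + l < p + q\<close> and the harmonic
polynomial \<open>P\<close> is orthogonal to the remaining factor because of its degree. If \<open>m > 0\<close>, expand
\<open>z \<bullet> w\<close> into its holomorphic and its antiholomorphic part: each term has a frequency under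
\<open>w \<mapsto> u w\<close> of at least \<open>p - q + k - l > 2 (p - i)\<close>, which is nonnegative exactly because
\<open>i \<le> p\<close>. So the terms have positive frequency and their means vanish.\<close>

lemma H_space_integral_vanishes:
  fixes P :: "complex^'n::finite \<Rightarrow> complex"
  assumes P: "P \<in> H_space p q" and i: "1 \<le> i" "i \<le> p"
    and l: "int l < \<bar>2 * int i - int p - int q - 1 + int k\<bar>"
  shows "(LINT w|unit_sphere_measure. P w * cdot b w ^ k * of_real (z \<bullet> w) ^ l) = 0"
proof (cases "2 * int i - int p - int q - 1 + int k < 0")
  case True
  have "complex_polynomial (\<lambda>w. cdot b w ^ k * of_real (z \<bullet> w) ^ l)"
    using bounded_linear_coordinate[of z]
    by (intro complex_polynomial_mult complex_polynomial_power complex_polynomial_linear bounded_linear_cdot)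
       (simp_all add: inner_commute)
  moreover have "homogeneous (k + l) (\<lambda>w. cdot b w ^ k * of_real (z \<bullet> w) ^ l)"
    by (simp add: homogeneous_def cdot_scaleR power_add power_mult_distrib)
  moreover have "k + l < p + q" using l True i by linarith
  moreover have "2 \<le> DIM(complex^'n)" by (simp add: Suc_leI)
  ultimately show ?thesis
    using harmonic_orthogonal_lower_degree[OF H_space_complex_polynomial[OF P] H_space_homogeneous[OF P] H_space_harmonic[OF P]]
    by (simp add: mult.assoc)
next
  case False
  define f where "f a w = P w * cdot b w ^ k * (cdot (vcnj z) w ^ a * cdot z (vcnj w) ^ (l - a))" for a w
  have cf: "complex_polynomial (f a)" for a
    unfolding f_def
    by (intro complex_polynomial_mult complex_polynomial_power complex_polynomial_linear bounded_linear_cdot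
        bounded_linear_cdot_vcnj H_space_complex_polynomial[OF P])
  have zero: "(LINT w|unit_sphere_measure. f a w) = 0" if "a \<le> l" for a
  proof (rule integral_sphere_positive_frequency)
    show "f a \<in> borel_measurable borel"
      by (intro borel_measurable_continuous_onI complex_polynomial_continuous_on cf)
    show "f a (u *s w) = u ^ (p + k + a) * cnj u ^ (q + (l - a)) * f a w" for u w
      by (simp add: f_def H_space_scale[OF P] vcnj_scale power_add power_mult_distrib)
    show "q + (l - a) < p + k + a" using l False i that by linarith
  qed
  have "P w * cdot b w ^ k * of_real (z \<bullet> w) ^ l = (\<Sum>a\<le>l. of_nat (l choose a) / 2 ^ l * f a w)" for w
    unfolding of_real_inner_eq_cdot power_divide binomial_ring f_def
    by (simp add: sum_distrib_left sum_divide_distrib mult_ac)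
  then have "(LINT w|unit_sphere_measure. P w * cdot b w ^ k * of_real (z \<bullet> w) ^ l)
      = (\<Sum>a\<le>l. LINT w|unit_sphere_measure. of_nat (l choose a) / 2 ^ l * f a w)"
    by (simp add: Bochner_Integration.integral_sum complex_polynomial_integrable[OF cf])
  then show ?thesis using zero by simp
qed

section \<open>Vanishing means in the standard complex structure\<close>

lemma norm_sum_exp_terms_le:
  fixes x :: complex
  shows "norm (\<Sum>k<K. x ^ k / fact k) \<le> exp (norm x)"
proof -
  have "norm (\<Sum>k<K. x ^ k / fact k) \<le> (\<Sum>k<K. norm x ^ k /\<^sub>R fact k)"
    by (rule order_trans[OF norm_sum], intro sum_mono)
       (simp add: norm_mult norm_inverse norm_power divide_inverse mult.commute)
  also have "\<dots> \<le> (\<Sum>k. norm x ^ k /\<^sub>R fact k)"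
    using exp_converges[of "norm x"] by (intro sum_le_suminf) (auto dest: sums_summable)
  also have "\<dots> = exp (norm x)" using exp_converges[of "norm x"] by (simp add: sums_iff)
  finally show ?thesis .
qed

text \<open>Each term of the exponential series contributes \<open>(b \<cdot> w)\<^sup>k \<rho>\<^sup>k\<close> and so is covered by
the preceding results. The exponential of the modulus dominates all partial sums.\<close>

lemma ray_integral_vanishes:
  fixes P :: "complex^'n::finite \<Rightarrow> complex"
  assumes P: "P \<in> H_space p q" and i: "1 \<le> i" "i \<le> p" and z: "norm z < s"
  shows "(LINT w|unit_sphere_measure. P w *
      of_real (ray_length z s w powi (2 * int i - int p - int q - 1) / ray_disc z s w) *
      exp (of_real (ray_length z s w) * cdot b w)) = 0"
proof -
  define m where "m = 2 * int i - int p - int q - 1"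
  have D0: "ray_disc z s w \<noteq> 0" and L0: "ray_length z s w \<noteq> 0" for w
    using ray_disc_pos[OF z, of w] ray_length_pos[OF z, of w] by auto
  define F where "F w = P w * of_real (ray_length z s w powi m / ray_disc z s w)" for w
  define y where "y w = of_real (ray_length z s w) * cdot b w" for w
  have cP: "continuous_on UNIV P"
    by (intro complex_polynomial_continuous_on H_space_complex_polynomial[OF P])
  have cb: "continuous_on UNIV (cdot b)" by (intro linear_continuous_on bounded_linear_cdot)
  have cpow: "continuous_on UNIV (\<lambda>w. ray_length z s w powi m)"
    using L0 by (cases "m \<ge> 0") (auto simp: power_int_def intro!: continuous_intros)
  have cF: "continuous_on UNIV F"
    unfolding F_def using D0 by (intro continuous_intros cP cpow) auto
  have cy: "continuous_on UNIV y"
    unfolding y_def by (intro continuous_intros cb)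
  have term_zero: "(LINT w|unit_sphere_measure. F w * (y w ^ k / fact k)) = 0" for k
  proof -
    have "(LINT w|unit_sphere_measure. P w * cdot b w ^ k * of_real (ray_length z s w powi (m + int k) / ray_disc z s w)) = 0"
    proof (rule integral_sphere_ray_power[OF _ _ z])
      show "continuous_on UNIV (\<lambda>w. P w * cdot b w ^ k)" by (intro continuous_intros cP cb)
      show "P (- w) * cdot b (- w) ^ k = (- 1) ^ (p + q + k) * (P w * cdot b w ^ k)" for w
      proof -
        have "- w = (- 1) *s w" by (simp add: vec_eq_iff)
        then show ?thesis
          by (simp only: H_space_scale[OF P] cdot_scale power_mult_distrib) (simp add: power_add)
      qed
      show "even (m + int k + 1 + int (p + q + k))" by (simp add: m_def)
      show "(LINT w|unit_sphere_measure. P w * cdot b w ^ k * of_real (z \<bullet> w) ^ l) = 0"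
        if "int l < \<bar>m + int k\<bar>" for l
        using that by (intro H_space_integral_vanishes[OF P i]) (simp add: m_def)
    qed
    moreover have "F w * (y w ^ k / fact k) = inverse (fact k) *
        (P w * cdot b w ^ k * of_real (ray_length z s w powi (m + int k) / ray_disc z s w))" for w
      using L0[of w] by (simp add: F_def y_def power_int_add power_mult_distrib divide_inverse mult_ac)
    ultimately show ?thesis by (simp only: integral_mult_right_zero mult_zero_right)
  qed
  have "(\<lambda>K. LINT w|unit_sphere_measure. F w * (\<Sum>k<K. y w ^ k / fact k)) \<longlonglongrightarrow>
      (LINT w|unit_sphere_measure. F w * exp (y w))"
  proof (rule integral_dominated_convergence)
    show "integrable unit_sphere_measure (\<lambda>w. norm (F w) * exp (norm (y w)))"
      by (intro integrable_unit_sphere_measure continuous_intros cF cy)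
    show "AE w in unit_sphere_measure. (\<lambda>K. F w * (\<Sum>k<K. y w ^ k / fact k)) \<longlonglongrightarrow> F w * exp (y w)"
    proof (intro AE_I2 tendsto_mult tendsto_const)
      fix w
      have "(\<lambda>k. y w ^ k / fact k) sums exp (y w)"
        using exp_converges[of "y w"] by (simp add: scaleR_conv_of_real divide_inverse mult.commute)
      then show "(\<lambda>K. \<Sum>k<K. y w ^ k / fact k) \<longlonglongrightarrow> exp (y w)" by (simp add: sums_def)
    qed
    show "AE w in unit_sphere_measure. norm (F w * (\<Sum>k<K. y w ^ k / fact k)) \<le> norm (F w) * exp (norm (y w))" for K
      by (intro AE_I2) (simp add: norm_mult mult_left_mono norm_sum_exp_terms_le)
    show "(\<lambda>w. F w * exp (y w)) \<in> borel_measurable unit_sphere_measure"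
      "(\<lambda>w. F w * (\<Sum>k<K. y w ^ k / fact k)) \<in> borel_measurable unit_sphere_measure" for K
      unfolding measurable_normalized_sphere_measure
      by (intro borel_measurable_continuous_onI continuous_intros cF cy; simp)+
  qed
  moreover have "(LINT w|unit_sphere_measure. F w * (\<Sum>k<K. y w ^ k / fact k)) = 0" for K
  proof -
    have "integrable unit_sphere_measure (\<lambda>w. F w * (y w ^ k / fact k))" for k
      by (intro integrable_unit_sphere_measure continuous_intros cF cy) auto
    then show ?thesis
      unfolding sum_distrib_left by (subst Bochner_Integration.integral_sum) (simp_all only: term_zero sum.neutral_const)
  qed
  ultimately show ?thesis by (simp add: LIMSEQ_const_iff F_def y_def m_def)
qed

text \<open>The case of the standard complex structure, with the Gaussian and the twist already combined into
one holomorphic exponential. On the ray \<open>x = \<rho> w\<close> the function times \<open>\<rho>\<^sup>2\<^sup>n\<^sup>-\<^sup>1\<close> becomes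
\<open>P(w) \<rho>\<^sup>2\<^sup>i\<^sup>-\<^sup>p\<^sup>-\<^sup>q\<^sup>-\<^sup>1 exp(\<rho> b \<cdot> w)\<close>.\<close>

theorem weighted_harmonic_mean_vanishes:
  fixes P :: "complex^'n::finite \<Rightarrow> complex" and b :: "complex^'n"
  assumes P: "P \<in> H_space p q" and i: "1 \<le> i" "i \<le> p" and z: "norm z < s"
  defines "G \<equiv> \<lambda>x. exp (cdot b x) * P x / of_real (norm x ^ (2 * (CARD('n) + p + q - i)))"
  shows "G \<in> borel_measurable borel" and "(LINT w|unit_sphere_measure. G (z + s *\<^sub>R w)) = 0"
proof -
  have cP: "continuous_on A P" for A
    by (intro complex_polynomial_continuous_on H_space_complex_polynomial[OF P])
  have cb: "continuous_on A (cdot b)" for A by (intro linear_continuous_on bounded_linear_cdot)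
  have [measurable]: "P \<in> borel_measurable borel" "cdot b \<in> borel_measurable borel"
    using cP cb by (auto intro: borel_measurable_continuous_onI)
  show Gm: "G \<in> borel_measurable borel" unfolding G_def by measurable
  have s: "s > 0" using le_less_trans[OF norm_ge_zero z] .
  have "norm x \<noteq> 0" if "x \<in> sphere z s" for x using that z by (auto simp: dist_norm)
  then have cG: "continuous_on (sphere z s) G"
    unfolding G_def by (intro continuous_intros cP cb) auto
  define m where "m = 2 * int i - int p - int q - 1"
  define K where "K w = P w * of_real (ray_length z s w powi m / ray_disc z s w) * exp (of_real (ray_length z s w) * cdot b w)" for w
  have [measurable]: "ray_disc z s \<in> borel_measurable borel" "ray_length z s \<in> borel_measurable borel"
    by measurable
  have "(LINT w|unit_sphere_measure. of_real (ray_length z s w ^ (DIM(complex^'n) - 1) * (s / ray_disc z s w)) * G (ray_length z s w *\<^sub>R w))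
     = (LINT w|unit_sphere_measure. of_real s * K w)"
  proof (rule integral_cong_AE)
    show "AE w in unit_sphere_measure. of_real (ray_length z s w ^ (DIM(complex^'n) - 1) * (s / ray_disc z s w)) * G (ray_length z s w *\<^sub>R w) = of_real s * K w"
      using AE_unit_sphere_measure
    proof eventually_elim
      fix w :: "complex^'n" assume w: "norm w = 1"
      define \<rho> where "\<rho> = ray_length z s w"
      have \<rho>: "\<rho> > 0" using ray_length_pos[OF z] by (simp add: \<rho>_def)
      have n: "CARD('n) \<ge> 1" by (simp add: Suc_leI)
      define N where "N = CARD('n)"
      have "\<rho> ^ (2 * N - 1) * \<rho> ^ (p + q) / \<rho> ^ (2 * (N + p + q - i)) = \<rho> powi (int (2 * N - 1) + int (p + q) - int (2 * (N + p + q - i)))"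
      proof -
        have "\<rho> ^ a * \<rho> ^ b / \<rho> ^ c = \<rho> powi (int a + int b - int c)" for a b c
          using \<rho> by (simp add: power_int_diff power_int_add)
        then show ?thesis .
      qed
      also have "int (2 * N - 1) + int (p + q) - int (2 * (N + p + q - i)) = m"
        using n i by (simp add: m_def N_def of_nat_diff)
      finally have e: "\<rho> ^ (2 * N - 1) * \<rho> ^ (p + q) / \<rho> ^ (2 * (N + p + q - i)) = \<rho> powi m" .
      have DN: "DIM(complex^'n) = 2 * N" by (simp add: N_def)
      have "G (\<rho> *\<^sub>R w) = exp (of_real \<rho> * cdot b w) * P w * of_real (\<rho> ^ (p + q) / \<rho> ^ (2 * (N + p + q - i)))"
        using \<rho> w by (simp add: G_def scaleR_eq_vector_scale H_space_scale[OF P] norm_complex_scale power_add N_def mult_ac)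
      then have "of_real (\<rho> ^ (DIM(complex^'n) - 1) * (s / ray_disc z s w)) * G (\<rho> *\<^sub>R w)
         = of_real s * P w * exp (of_real \<rho> * cdot b w) * of_real ((\<rho> ^ (2 * N - 1) * \<rho> ^ (p + q) / \<rho> ^ (2 * (N + p + q - i))) / ray_disc z s w)"
        unfolding DN by (simp add: mult_ac)
      then show "of_real (ray_length z s w ^ (DIM(complex^'n) - 1) * (s / ray_disc z s w)) * G (ray_length z s w *\<^sub>R w) = of_real s * K w"
        unfolding e \<rho>_def[symmetric] K_def by (simp add: \<rho>_def mult_ac)
    qed
  qed (use Gm in \<open>simp_all add: K_def power_int_def\<close>)
  also have "\<dots> = 0"
  proof -
    have "(LINT w|unit_sphere_measure. K w) = 0"
      using ray_integral_vanishes[OF P i z, of b] by (simp only: K_def m_def)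
    then show ?thesis by (simp only: integral_mult_right_zero mult_zero_right)
  qed
  finally have "of_real (s ^ (DIM(complex^'n) - 1)) * (LINT w|unit_sphere_measure. G (z + s *\<^sub>R w)) = 0"
    using eccentric_mean[OF cG Gm z] by simp
  then show "(LINT w|unit_sphere_measure. G (z + s *\<^sub>R w)) = 0" using s by simp
qed

section \<open>Rotation to the standard complex structure\<close>

lemma sum_UNIV_Plus: "(\<Sum>k\<in>(UNIV :: ('n::finite + 'n) set). f k) = (\<Sum>j\<in>UNIV. f (Inl j)) + (\<Sum>j\<in>UNIV. f (Inr j))"
  unfolding UNIV_Plus_UNIV[symmetric] by (subst sum.Plus) auto

lemma inner_realify: "realify z \<bullet> realify w = z \<bullet> w"
  by (simp add: inner_vec_def sum_UNIV_Plus realify_def inner_complex_def sum.distrib)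

lemma inner_complexify: "z \<bullet> complexify x = realify z \<bullet> x"
  using inner_realify[of z "complexify x"] by simp

lemma realify_add: "realify (z + w) = realify z + realify w"
  by (simp add: realify_def vec_eq_iff split: sum.split)

lemma realify_scaleR: "realify (t *\<^sub>R z) = t *\<^sub>R realify z"
  by (simp add: realify_def vec_eq_iff split: sum.split)

lemma complexify_add: "complexify (x + y) = complexify x + complexify y"
  by (simp add: complexify_def vec_eq_iff complex_eq_iff)

lemma complexify_scaleR: "complexify (t *\<^sub>R x) = t *\<^sub>R complexify x"
  by (simp add: complexify_def vec_eq_iff complex_eq_iff)

lemma linear_cact: "linear (cact M)"
  by (intro linearI) (simp_all add: cact_def realify_add realify_scaleR complexify_add complexify_scaleR
      matrix_vector_right_distrib matrix_vector_mult_scaleR)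

lemma orthogonal_matrix_inner:
  fixes A :: "real^'k::finite^'k"
  assumes "orthogonal_matrix A"
  shows "(A *v x) \<bullet> (A *v y) = x \<bullet> y"
proof -
  have "(A *v x) \<bullet> (A *v y) = x \<bullet> (transpose A *v (A *v y))"
    by (metis dot_lmul_matrix inner_commute vector_transpose_matrix transpose_transpose)
  also have "transpose A *v (A *v y) = y"
    using assms by (simp add: matrix_vector_mul_assoc orthogonal_matrix_def)
  finally show ?thesis .
qed

lemma norm_cact:
  assumes "orthogonal_matrix A"
  shows "norm (cact A z) = norm z"
proof -
  have "cact A z \<bullet> cact A z = z \<bullet> z"
    unfolding cact_def inner_realify[symmetric] realify_complexify
    by (rule orthogonal_matrix_inner[OF assms])
  then show ?thesis by (simp add: norm_eq_sqrt_inner)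
qed

lemma twisted_phase_eq:
  "(\<Sum>j\<in>UNIV. lam $ j * Re (cdot z (vcnj (cact (U j) w)))) = realify z \<bullet> (V_mat U lam *v realify w)"
proof -
  have "Re (cdot z (vcnj (cact (U j) w))) = realify z \<bullet> (U j *v realify w)" for j
  proof -
    have "Re (cdot z (vcnj (cact (U j) w))) = cact (U j) w \<bullet> z"
      by (simp add: inner_eq_Re_cdot cdot_def mult.commute)
    also have "\<dots> = realify z \<bullet> (U j *v realify w)"
      by (simp add: inner_commute[of _ z] cact_def inner_complexify)
    finally show ?thesis .
  qed
  moreover have "V_mat U lam *v x = (\<Sum>j\<in>UNIV. lam $ j *\<^sub>R (U j *v x))" for x
  proof -
    have "(\<Sum>j\<in>J. lam $ j *\<^sub>R U j) *v x = (\<Sum>j\<in>J. lam $ j *\<^sub>R (U j *v x))" for J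
      by (induction J rule: infinite_finite_induct)
         (simp_all add: matrix_vector_mult_add_rdistrib scaleR_matrix_vector_assoc)
    then show ?thesis by (simp add: V_mat_def)
  qed
  ultimately show ?thesis by (simp add: inner_sum_right)
qed

lemma eigenframe_action:
  assumes "eigenframe U lam u v"
  shows "V_mat U lam *v u j = - norm lam *\<^sub>R v j" and "V_mat U lam *v v j = norm lam *\<^sub>R u j"
proof -
  have eig: "map_matrix of_real (V_mat U lam) *v (\<chi> k. of_real (u j $ k) + \<i> * of_real (v j $ k)) =
      (\<i> * of_real (norm lam)) *s (\<chi> k. of_real (u j $ k) + \<i> * of_real (v j $ k))"
    using assms by (simp add: eigenframe_def eigenvector_def)
  have "(\<Sum>l\<in>UNIV. of_real (V_mat U lam $ k $ l) * (of_real (u j $ l) + \<i> * of_real (v j $ l))) =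
      (\<i> * of_real (norm lam)) * (of_real (u j $ k) + \<i> * of_real (v j $ k))" for k
    using arg_cong[OF eig, of "\<lambda>x. x $ k"] by (simp add: matrix_vector_mult_def)
  from arg_cong[OF this, of Re] arg_cong[OF this, of Im]
  show "V_mat U lam *v u j = - norm lam *\<^sub>R v j" and "V_mat U lam *v v j = norm lam *\<^sub>R u j"
    by (simp_all add: vec_eq_iff matrix_vector_mult_def)
qed

lemma A_mat_mult:
  "A_mat u v *v x = (\<Sum>j\<in>UNIV. (sqrt 2 * x $ Inl j) *\<^sub>R v j + (sqrt 2 * x $ Inr j) *\<^sub>R u j)"
  by (simp add: vec_eq_iff matrix_vector_mult_def A_mat_def sum_UNIV_Plus sum.distrib mult_ac)

text \<open>The columns of \<open>A\<^sub>\<lambda>\<close> are arranged such that \<open>V\<^sub>\<lambda>\<close> becomes \<open>|\<lambda>|\<close> times the multiplication by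
\<open>\<i>\<close>.\<close>

lemma V_mat_A_mat:
  assumes "eigenframe U lam u v"
  shows "V_mat U lam *v (A_mat u v *v realify w) = norm lam *\<^sub>R (A_mat u v *v realify (\<i> *s w))"
proof -
  have lin: "linear ((*v) (V_mat U lam))" by (rule matrix_vector_mul_linear)
  have "V_mat U lam *v (A_mat u v *v realify w) =
     (\<Sum>j\<in>UNIV. (sqrt 2 * realify w $ Inl j) *\<^sub>R (V_mat U lam *v v j) + (sqrt 2 * realify w $ Inr j) *\<^sub>R (V_mat U lam *v u j))"
    unfolding A_mat_mult by (simp add: linear_sum[OF lin] linear_add[OF lin] linear_cmul[OF lin])
  also have "\<dots> = norm lam *\<^sub>R (A_mat u v *v realify (\<i> *s w))"
    unfolding A_mat_mult eigenframe_action[OF assms] scaleR_sum_right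
    by (intro sum.cong refl) (simp add: realify_def algebra_simps)
  finally show ?thesis .
qed

lemma twisted_phase_rotated:
  assumes "eigenframe U lam u v"
  shows "(\<Sum>j\<in>UNIV. lam $ j * Re (cdot (cact (A_mat u v) z) (vcnj (cact (U j) (cact (A_mat u v) w))))) =
    - norm lam * Im (cdot (vcnj z) w)"
proof -
  have A: "orthogonal_matrix (A_mat u v)" using assms by (simp add: eigenframe_def)
  have "(\<Sum>j\<in>UNIV. lam $ j * Re (cdot (cact (A_mat u v) z) (vcnj (cact (U j) (cact (A_mat u v) w))))) =
      (A_mat u v *v realify z) \<bullet> (V_mat U lam *v (A_mat u v *v realify w))"
    unfolding twisted_phase_eq by (simp add: cact_def)
  also have "\<dots> = norm lam * (z \<bullet> (\<i> *s w))"
    unfolding V_mat_A_mat[OF assms] by (simp add: orthogonal_matrix_inner[OF A] inner_realify)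
  also have "\<dots> = - norm lam * Im (cdot (vcnj z) w)"
    by (simp add: inner_eq_Re_cdot)
  finally show ?thesis .
qed

text \<open>On the sphere \<open>|x - z| = s\<close> the number \<open>|x|\<^sup>2\<close> differs from \<open>2 Re (z\<^sup>* \<cdot> x)\<close>, with \<open>z\<^sup>*\<close> the conjugate of \<open>z\<close>, by a constant,
and the twist is the exponential of a multiple of \<open>Im (z\<^sup>* \<cdot> x)\<close> with the same
coefficient. So the rate \<open>a / 4\<close> of the Gaussian is exactly the one for which the product
depends holomorphically on \<open>x\<close>.\<close>

lemma gaussian_twist_on_sphere:
  fixes x z :: "complex^'n::finite"
  assumes "norm (z - x) = s"
  shows "of_real (exp (a / 4 * (norm x)\<^sup>2)) * exp (\<i> / 2 * of_real (- a * Im (cdot (vcnj z) (z - x)))) =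
    of_real (exp (a / 4 * (s\<^sup>2 - (norm z)\<^sup>2))) * exp (cdot (of_real (a / 2) *s vcnj z) x)"
proof -
  have "s\<^sup>2 = (norm z)\<^sup>2 + (norm x)\<^sup>2 - 2 * (z \<bullet> x)"
    unfolding assms[symmetric] power2_norm_eq_inner
    by (simp add: inner_diff_left inner_diff_right inner_commute)
  then have nx: "(norm x)\<^sup>2 = s\<^sup>2 - (norm z)\<^sup>2 + 2 * Re (cdot (vcnj z) x)"
    by (simp add: inner_eq_Re_cdot)
  have n: "a / 4 * (norm x)\<^sup>2 = a / 4 * (s\<^sup>2 - (norm z)\<^sup>2) + a / 2 * Re (cdot (vcnj z) x)"
    unfolding nx by (simp add: field_simps)
  have "Im (cdot (vcnj z) z) = 0"
    by (simp add: cdot_def vcnj_def Im_sum)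
  then have im: "Im (cdot (vcnj z) (z - x)) = - Im (cdot (vcnj z) x)"
    by (simp add: cdot_diff)
  have "of_real (a / 4 * (norm x)\<^sup>2) + \<i> / 2 * of_real (- a * Im (cdot (vcnj z) (z - x)))
      = of_real (a / 4 * (s\<^sup>2 - (norm z)\<^sup>2)) + cdot (of_real (a / 2) *s vcnj z) x"
    unfolding n im by (simp add: complex_eq_iff)
  then show ?thesis
    unfolding exp_of_real[symmetric] exp_add[symmetric] by simp
qed

text \<open>The integrand is kept cut off to the sphere, because only there it is known to be continuous and
therefore measurable.\<close>

lemma twisted_mean_eq_unit_sphere:
  fixes f :: "complex^'n::finite \<Rightarrow> complex"
    and U :: "'m::finite \<Rightarrow> real^('n + 'n)^('n + 'n)" and lam :: "real^'m"
  assumes s: "s > 0" and f: "continuous_on (sphere z s) f"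
  defines "F \<equiv> \<lambda>w. indicator (sphere 0 s) w *\<^sub>R (f (z - w) *
        exp (\<i> / 2 * of_real (\<Sum>j\<in>UNIV. lam $ j * Re (cdot z (vcnj (cact (U j) w))))))"
  shows "F \<in> borel_measurable borel" "twisted_mean U lam f s z = (LINT w|unit_sphere_measure. F (s *\<^sub>R w))"
proof -
  have lin: "continuous_on A (\<lambda>w. V_mat U lam *v realify w)" for A
    by (intro linear_continuous_on)
       (simp add: linear_iff realify_add realify_scaleR matrix_vector_right_distrib matrix_vector_mult_scaleR linear_linear)
  have "continuous_on (sphere 0 s) (\<lambda>w. f (z - w))"
    by (rule continuous_on_compose2[OF f]) (auto intro!: continuous_intros simp: dist_norm)
  then have "continuous_on (sphere 0 s) (\<lambda>w. f (z - w) *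
        exp (\<i> / 2 * of_real (\<Sum>j\<in>UNIV. lam $ j * Re (cdot z (vcnj (cact (U j) w))))))"
    unfolding twisted_phase_eq by (intro continuous_intros lin)
  then show Fm: "F \<in> borel_measurable borel"
    unfolding F_def by (intro borel_measurable_continuous_on_indicator) (auto intro: borel_closed)
  show "twisted_mean U lam f s z = (LINT w|unit_sphere_measure. F (s *\<^sub>R w))"
    unfolding twisted_mean_def set_lebesgue_integral_def F_def[symmetric]
    by (subst normalized_sphere_measure_eq_distr, subst integral_distr) (use Fm in auto)
qed

theorem theorem4p1:
  fixes U :: "'m::finite \<Rightarrow> real^('n::finite + 'n)^('n + 'n)"
    and lam :: "real^'m"
    and u v :: "'n \<Rightarrow> real^('n + 'n)"
    and r :: real
    and p q i :: nat
    and P h :: "complex^'n \<Rightarrow> complex"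
  assumes "htype_matrices U"
    and "lam \<noteq> 0"
    and "eigenframe U lam u v"
    and "r \<ge> 0"
    and "P \<in> H_lambda_space u v p q"
    and "1 \<le> i" and "i \<le> p"
    and "\<And>z. z \<noteq> 0 \<Longrightarrow> h z = of_real (exp (norm lam / 4 * (norm z)\<^sup>2)) * P z /
                   of_real (norm z ^ (2 * (CARD('n) + p + q - i)))"
  shows "h \<in> Z_space U lam r \<infinity>"
proof -
  note h = assms(8)
  have "continuous_on UNIV P"
  proof -
    obtain F where F: "\<And>p' q'. p' + q' = p + q \<Longrightarrow> F (p', q') \<in> H_space p' q'"
      and P: "P = (\<lambda>z. \<Sum>k\<in>{(p', q'). p' + q' = p + q}. F k z)"
      using assms(5) unfolding H_lambda_space_def H_sum_def by blast
    show ?thesis unfolding P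
      by (intro continuous_on_sum) (auto intro!: complex_polynomial_continuous_on H_space_complex_polynomial F)
  qed
  then have cP: "continuous_on S P" for S by (rule continuous_on_subset) simp
  have ch: "continuous_on S h" if "0 \<notin> S" for S
  proof -
    have "continuous_on S (\<lambda>z. of_real (exp (norm lam / 4 * (norm z)\<^sup>2)) * P z /
                   of_real (norm z ^ (2 * (CARD('n) + p + q - i))))"
      using that by (intro continuous_intros cP) auto
    then show ?thesis
      by (rule continuous_on_eq) (use that in \<open>metis h\<close>)
  qed
  have mean: "twisted_mean U lam h s z = 0" if z: "norm z < s" for z s
  proof -
    define T where "T = cact (A_mat u v)"
    have oA: "orthogonal_matrix (A_mat u v)" using assms(3) by (simp add: eigenframe_def)
    have T: "linear T" "\<And>x. norm (T x) = norm x"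
      by (auto simp: T_def linear_cact norm_cact[OF oA])
    have PT: "(\<lambda>x. P (T x)) \<in> H_space p q"
      using assms(5) by (simp add: H_lambda_space_def T_def)
    obtain y where y: "z = T y" using linear_isometry_surj[OF T] by (metis surjD)
    have yz: "norm y = norm z" by (simp add: y T(2))
    have s: "s > 0" using le_less_trans[OF norm_ge_zero z] .
    have "0 \<notin> sphere z s" using z by (auto simp: dist_norm)
    note cs = ch[OF this]
    define F where "F w = indicator (sphere 0 s) w *\<^sub>R (h (z - w) *
        exp (\<i> / 2 * of_real (\<Sum>j\<in>UNIV. lam $ j * Re (cdot z (vcnj (cact (U j) w))))))" for w
    have Fm [measurable]: "F \<in> borel_measurable borel"
      and Fi: "twisted_mean U lam h s z = (LINT w|unit_sphere_measure. F (s *\<^sub>R w))"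
      unfolding F_def[abs_def] using twisted_mean_eq_unit_sphere[OF s cs] by blast+
    define b where "b = of_real (norm lam / 2) *s vcnj y"
    define G where "G x = exp (cdot b x) * P (T x) / of_real (norm x ^ (2 * (CARD('n) + p + q - i)))" for x
    have yl: "norm y < s" using z yz by simp
    note G0 = weighted_harmonic_mean_vanishes[OF PT assms(6,7) yl, of b, folded G_def]
    have [measurable]: "G \<in> borel_measurable borel" by (rule G0(1))
    define C where "C = complex_of_real (exp (norm lam / 4 * (s\<^sup>2 - (norm y)\<^sup>2)))"
    have "twisted_mean U lam h s z = (LINT w|unit_sphere_measure. F (s *\<^sub>R T w))"
      unfolding Fi by (rule integral_unit_sphere_measure_isometry[OF T, symmetric]) simp
    also have "\<dots> = (LINT w|unit_sphere_measure. C * G (y + s *\<^sub>R (- w)))"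
    proof (rule integral_cong_AE)
      have [measurable]: "T \<in> borel_measurable borel" by (rule measurable_linear[OF T(1)])
      show "(\<lambda>w. F (s *\<^sub>R T w)) \<in> borel_measurable unit_sphere_measure"
        "(\<lambda>w. C * G (y + s *\<^sub>R (- w))) \<in> borel_measurable unit_sphere_measure" by simp_all
      show "AE w in unit_sphere_measure. F (s *\<^sub>R T w) = C * G (y + s *\<^sub>R (- w))"
        using AE_unit_sphere_measure
      proof eventually_elim
        fix w :: "complex^'n" assume w: "norm w = 1"
        define x where "x = y - s *\<^sub>R w"
        have sw: "s *\<^sub>R T w = T (y - x)" by (simp add: x_def linear_cmul[OF T(1)])
        have zx: "z - s *\<^sub>R T w = T x" by (simp add: x_def y linear_cmul[OF T(1)] linear_diff[OF T(1)])
        have nx: "norm (y - x) = s" using w s by (simp add: x_def)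
        have x0: "x \<noteq> 0" using nx yl by auto
        then have Tx0: "T x \<noteq> 0" using T(2)[of x] by (metis norm_eq_zero)
        have "F (s *\<^sub>R T w) = h (T x) * exp (\<i> / 2 * of_real (\<Sum>j\<in>UNIV. lam $ j * Re (cdot (T y) (vcnj (cact (U j) (T (y - x)))))))"
          using w s by (simp add: F_def zx T(2) flip: sw y)
        also have "\<dots> = h (T x) * exp (\<i> / 2 * of_real (- norm lam * Im (cdot (vcnj y) (y - x))))"
          unfolding T_def twisted_phase_rotated[OF assms(3)] ..
        also have "\<dots> = (of_real (exp (norm lam / 4 * (norm x)\<^sup>2)) * exp (\<i> / 2 * of_real (- norm lam * Im (cdot (vcnj y) (y - x)))))
             * P (T x) / of_real (norm x ^ (2 * (CARD('n) + p + q - i)))"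
          by (simp add: h[OF Tx0] T(2) mult_ac)
        also have "\<dots> = C * G x"
          unfolding gaussian_twist_on_sphere[OF nx] C_def[symmetric] by (simp add: G_def b_def mult_ac)
        finally show "F (s *\<^sub>R T w) = C * G (y + s *\<^sub>R (- w))" by (simp add: x_def)
      qed
    qed
    also have "\<dots> = C * (LINT w|unit_sphere_measure. G (y + s *\<^sub>R (- w)))" by simp
    also have "(LINT w|unit_sphere_measure. G (y + s *\<^sub>R (- w))) = (LINT w|unit_sphere_measure. G (y + s *\<^sub>R w))"
      by (rule integral_unit_sphere_measure_isometry[of uminus "\<lambda>w. G (y + s *\<^sub>R w)"]) (auto simp: linear_iff)
    also have "\<dots> = 0" by (rule G0(2))
    finally show ?thesis by simp
  qed
  show ?thesis
    unfolding Z_space_def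
  proof (intro CollectI conjI allI impI)
    show "continuous_on (annulus r \<infinity>) h"
      using assms(4) by (intro ch) (simp add: annulus_def)
    fix z :: "complex^'n" and s :: real
    assume s: "s > 0" and sub: "sphere z s \<subseteq> annulus r \<infinity>" "cball 0 r \<subseteq> cball z s"
    have "0 \<in> cball (0 :: complex^'n) r" using assms(4) by simp
    then have "0 \<in> cball z s" using sub(2) by blast
    moreover have "0 \<notin> sphere z s" using subsetD[OF sub(1), of 0] assms(4)
      by (auto simp: annulus_def simp del: mem_sphere)
    ultimately have "norm z < s" by (simp add: dist_norm)
    then show "twisted_mean U lam h s z = 0" by (rule mean)
  qed
qed

end
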